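(* For each $n$, let $C$ be uniformly distributed on $\mathcal{E}_n$, let $M_n=\max_{1\leq i<j\leq n}|C_{ij}|$, and let $\mu_n=\log\frac{n^4}{\log n}$. Then, as $n\rightarrow\infty$, $(n+1)M_n^2-\mu_n$ converges in distribution to the Gumbel distribution with cumulative distribution function $$ \mathcal{G}(t)=\exp\Bigl\{-\tfrac{1}{\sqrt{8\pi}}e^{-t/2}\Bigr\},\qquad t\in\mathbb{R}. $$ In particular, $\sqrt{(n+1)/\log n}\,M_n\rightarrow2$ in probability.
   Context: $\mathcal{E}_n=\{C\in\mathbb{R}^{n\times n}: C=C',\ C\succeq 0,\ C_{ii}=1 \text{ for all } i\}$ is the set of $n\times n$ correlation matrices; the uniform distribution on it is normalized $d$-dimensional Lebesgue measure, $d=n(n-1)/2$, in the off-diagonal coordinates $(C_{ij})_{i<j}$. *)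

theory Defs
  imports "HOL-Probability.Probability" "HOL-Real_Asymp.Real_Asymp" "Jordan_Normal_Form.Matrix"
begin

definition positive_semidefinite :: "real mat \<Rightarrow> bool" where
  "positive_semidefinite A \<longleftrightarrow>
     (\<forall>v \<in> carrier_vec (dim_row A). 0 \<le> scalar_prod v (A *\<^sub>v v))"

definition correlation_matrices :: "nat \<Rightarrow> real mat set" where
  "correlation_matrices n =
     {C \<in> carrier_mat n n. transpose_mat C = C \<and> positive_semidefinite C \<and>
        (\<forall>i<n. C $$ (i, i) = 1)}"

text \<open>Matrix indices start at 0, so the off-diagonal positions are the pairs i < j < n.\<close>

definition offdiag :: "nat \<Rightarrow> (nat \<times> nat) set" where
  "offdiag n = {(i, j). i < j \<and> j < n}"

definition offdiag_coords :: "nat \<Rightarrow> real mat \<Rightarrow> (nat \<times> nat \<Rightarrow> real)" where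
  "offdiag_coords n C = (\<lambda>p\<in>offdiag n. C $$ p)"

abbreviation lebesgue_offdiag :: "nat \<Rightarrow> (nat \<times> nat \<Rightarrow> real) measure" where
  "lebesgue_offdiag n \<equiv> PiM (offdiag n) (\<lambda>_. lborel)"

text \<open>A correlation matrix is determined by its off-diagonal coordinates, so the law of a random
  one is specified by the law of these coordinates.\<close>

definition uniform_correlation_matrix ::
    "'a measure \<Rightarrow> nat \<Rightarrow> ('a \<Rightarrow> real mat) \<Rightarrow> bool" where
  "uniform_correlation_matrix P n C \<longleftrightarrow>
     (AE \<omega> in P. C \<omega> \<in> correlation_matrices n) \<and>
     (\<lambda>\<omega>. offdiag_coords n (C \<omega>)) \<in> measurable P (lebesgue_offdiag n) \<and>
     distr P (lebesgue_offdiag n) (\<lambda>\<omega>. offdiag_coords n (C \<omega>)) =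
       uniform_measure (lebesgue_offdiag n) (offdiag_coords n ` correlation_matrices n)"

definition max_offdiag :: "nat \<Rightarrow> real mat \<Rightarrow> real" where
  "max_offdiag n C = Max ((\<lambda>p. \<bar>C $$ p\<bar>) ` offdiag n)"

definition centering :: "nat \<Rightarrow> real" where
  "centering n = ln (real n ^ 4 / ln (real n))"

definition gumbel_cdf :: "real \<Rightarrow> real" where
  "gumbel_cdf t = exp (- (1 / sqrt (8 * pi)) * exp (- t / 2))"

definition gumbel :: "real measure" where
  "gumbel = interval_measure gumbel_cdf"

lemma gumbel_cdf_properties:
  shows "x \<le> y \<Longrightarrow> gumbel_cdf x \<le> gumbel_cdf y"
    and "continuous (at_right a) gumbel_cdf"
    and "(gumbel_cdf \<longlongrightarrow> 0) at_bot"
    and "(gumbel_cdf \<longlongrightarrow> 1) at_top"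
proof -
  let ?c = "1 / sqrt (8 * pi)"
  have c: "?c > 0" by simp
  show "x \<le> y \<Longrightarrow> gumbel_cdf x \<le> gumbel_cdf y"
    unfolding gumbel_cdf_def by (simp add: divide_right_mono)
  show "continuous (at_right a) gumbel_cdf"
    unfolding gumbel_cdf_def by (intro continuous_intros) auto
  have "((\<lambda>t. exp (- c * exp (- t / 2))) \<longlongrightarrow> 0) at_bot" if "c > 0" for c :: real
    using that by real_asymp
  from this[OF c] show "(gumbel_cdf \<longlongrightarrow> 0) at_bot"
    unfolding gumbel_cdf_def .
  have "((\<lambda>t. exp (- c * exp (- t / 2))) \<longlongrightarrow> 1) at_top" if "c > 0" for c :: real
    using that by real_asymp
  from this[OF c] show "(gumbel_cdf \<longlongrightarrow> 1) at_top"
    unfolding gumbel_cdf_def .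
qed

lemma real_distribution_gumbel: "real_distribution gumbel"
  unfolding gumbel_def
  by (intro real_distribution_interval_measure gumbel_cdf_properties)

lemma cdf_gumbel: "cdf gumbel = gumbel_cdf"
  unfolding gumbel_def
  by (intro cdf_interval_measure gumbel_cdf_properties)

end

theory Submission
  imports Defs
begin

text \<open>Fix indices \<open>i \<noteq> j\<close>. Writing a correlation matrix as a Gram matrix, the unit vector with index \<open>j\<close>
  is \<open>s v\<^sub>i + \<surd>(1 - s\<^sup>2) v'\<close> with \<open>v'\<close> orthogonal to \<open>v\<^sub>i\<close>. In coordinates, this is for fixed \<open>s = C\<^sub>i\<^sub>j\<close> an
  affine substitution of the other \<open>n - 2\<close> entries in row \<open>j\<close>, with scaling factor \<open>\<surd>(1 - s\<^sup>2)\<close>, and it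
  reduces membership in the set of correlation matrices to the case \<open>s = 0\<close>. By Fubini, \<open>C\<^sub>i\<^sub>j\<close> is
  independent of all entries not involving \<open>j\<close>, with density proportional to \<open>(1 - s\<^sup>2)\<close> to the power
  \<open>(n - 2) / 2\<close>; in particular the entries are pairwise independent.

  Let \<open>p\<close> be the probability that one entry exceeds \<open>x\<close> in absolute value, and \<open>d\<^sub>k\<close> the probability that
  the leading \<open>k \<times> k\<close> corner has no such entry. Adding row \<open>k\<close>, the union bound and the Bonferroni
  inequality give \<open>d\<^sub>k (1 - k p) \<le> d\<^sub>k\<^sub>+\<^sub>1 \<le> d\<^sub>k (1 - k p) + k\<^sup>2 p\<^sup>2\<close>. Hence \<open>d\<^sub>n\<close> tends to \<open>exp (- \<Lambda>)\<close> as soon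
  as \<open>n\<^sup>2 p / 2\<close> tends to \<open>\<Lambda>\<close>, and for the given threshold this is a Gaussian tail computation.\<close>

section \<open>Off-diagonal coordinates of correlation matrices\<close>

text \<open>Rebuilds the symmetric matrix with unit diagonal from its strict upper triangle, so that
  later arguments treat \<open>i < j\<close> and \<open>j < i\<close> alike.\<close>

definition corr_entry :: "(nat \<times> nat \<Rightarrow> real) \<Rightarrow> nat \<Rightarrow> nat \<Rightarrow> real" where
  "corr_entry f i j = (if i = j then 1 else f (min i j, max i j))"

text \<open>Vectors are functions on all of \<open>nat\<close>, of which only the values below
  \<open>n\<close> enter; this avoids dimension bookkeeping.\<close>

definition corr_form :: "nat \<Rightarrow> (nat \<times> nat \<Rightarrow> real) \<Rightarrow> (nat \<Rightarrow> real) \<Rightarrow> real" where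
  "corr_form n f v = (\<Sum>k<n. \<Sum>l<n. corr_entry f k l * v k * v l)"

definition corr_coords :: "nat \<Rightarrow> (nat \<times> nat \<Rightarrow> real) set" where
  "corr_coords n = {f \<in> extensional (offdiag n). \<forall>v. 0 \<le> corr_form n f v}"

lemma corr_entry_diag [simp]: "corr_entry f i i = 1"
  by (simp add: corr_entry_def)

lemma corr_entry_commute: "corr_entry f i j = corr_entry f j i"
  by (simp add: corr_entry_def min.commute max.commute)

lemma corr_entry_less: "i < j \<Longrightarrow> corr_entry f i j = f (i, j)"
  by (simp add: corr_entry_def)

lemma min_max_in_offdiag: "i < n \<Longrightarrow> j < n \<Longrightarrow> i \<noteq> j \<Longrightarrow> (min i j, max i j) \<in> offdiag n"
  by (auto simp: offdiag_def)

lemma finite_offdiag [simp]: "finite (offdiag n)"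
  by (rule finite_subset[of _ "{..<n} \<times> {..<n}"]) (auto simp: offdiag_def)

text \<open>From here on matrices are replaced by their coordinate functions: both quadratic forms
  agree, and symmetry and the unit diagonal are built into \<open>corr_entry\<close>.\<close>

lemma offdiag_coords_correlation_matrices:
  "offdiag_coords n ` correlation_matrices n = corr_coords n"
proof (intro equalityI subsetI)
  have form: "scalar_prod v (A *\<^sub>v v) = corr_form n f (\<lambda>i. v $ i)"
    if "A \<in> carrier_mat n n" "v \<in> carrier_vec n"
      "\<And>k l. k < n \<Longrightarrow> l < n \<Longrightarrow> A $$ (k, l) = corr_entry f k l" for A v f
  proof -
    have "scalar_prod v (A *\<^sub>v v) = (\<Sum>k<n. v $ k * (\<Sum>l<n. A $$ (k, l) * v $ l))"
      using that(1,2) by (auto simp: scalar_prod_def mult_mat_vec_def atLeast0LessThan intro!: sum.cong)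
    also have "\<dots> = corr_form n f (\<lambda>i. v $ i)"
      unfolding corr_form_def sum_distrib_left by (intro sum.cong refl) (simp add: that(3))
    finally show ?thesis .
  qed
  {
    fix f assume "f \<in> offdiag_coords n ` correlation_matrices n"
    then obtain A where A: "A \<in> correlation_matrices n" and f: "f = offdiag_coords n A"
      by auto
    from A have carr: "A \<in> carrier_mat n n" and tr: "transpose_mat A = A"
      and psd: "positive_semidefinite A" and diag: "\<And>i. i < n \<Longrightarrow> A $$ (i, i) = 1"
      by (auto simp: correlation_matrices_def)
    have sym: "A $$ (k, l) = A $$ (l, k)" if "k < n" "l < n" for k l
      using carr that arg_cong[OF tr, of "\<lambda>B. B $$ (k, l)"] by simp
    have ent: "A $$ (k, l) = corr_entry f k l" if "k < n" "l < n" for k l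
      using that diag sym[of k l] min_max_in_offdiag[of k n l]
      by (cases k l rule: linorder_cases)
         (auto simp: f offdiag_coords_def corr_entry_def)
    have "0 \<le> corr_form n f v" for v
    proof -
      have "corr_form n f v = corr_form n f (\<lambda>i. vec n v $ i)"
        by (simp add: corr_form_def)
      also have "\<dots> = scalar_prod (vec n v) (A *\<^sub>v vec n v)"
        using form[OF carr, of "vec n v" f] ent by simp
      also have "\<dots> \<ge> 0"
        using psd carr by (auto simp: positive_semidefinite_def)
      finally show ?thesis .
    qed
    then show "f \<in> corr_coords n"
      by (auto simp: corr_coords_def f offdiag_coords_def)
  }
  fix f assume f: "f \<in> corr_coords n"
  define A where "A = mat n n (\<lambda>(k, l). corr_entry f k l)"
  have carr: "A \<in> carrier_mat n n" by (simp add: A_def)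
  have ent: "A $$ (k, l) = corr_entry f k l" if "k < n" "l < n" for k l
    using that by (simp add: A_def)
  have "transpose_mat A = A"
    by (rule eq_matI) (auto simp: A_def corr_entry_commute)
  moreover have "positive_semidefinite A"
    using f carr form[OF carr _ ent] by (auto simp: positive_semidefinite_def corr_coords_def)
  ultimately have "A \<in> correlation_matrices n"
    using carr ent by (auto simp: correlation_matrices_def)
  moreover have "f = offdiag_coords n A"
    using f by (intro extensionalityI[of f "offdiag n"])
      (auto simp: corr_coords_def offdiag_coords_def offdiag_def ent corr_entry_less)
  ultimately show "f \<in> offdiag_coords n ` correlation_matrices n" by blast
qed

section \<open>Measurability of the set of correlation matrices\<close>

lemma measurable_corr_entry [measurable]:
  assumes "i < n" "j < n"
  shows "(\<lambda>f. corr_entry f i j) \<in> borel_measurable (lebesgue_offdiag n)"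
proof (cases "i = j")
  case False
  then show ?thesis
    using measurable_component_singleton[OF min_max_in_offdiag[OF assms False], of "\<lambda>_. lborel"]
    by (simp add: corr_entry_def)
qed simp

text \<open>The form is continuous in the vector, so it suffices to test rational vectors. Only
  finitely many components enter, so lists represent them; there are countably many, and
  measurability follows.\<close>

lemma corr_coords_rational:
  "corr_coords n = {f \<in> space (lebesgue_offdiag n).
     \<forall>q \<in> (UNIV :: rat list set). 0 \<le> corr_form n f (\<lambda>i. of_rat (q ! i))}"
proof -
  have "0 \<le> corr_form n f v"
    if q: "\<And>q :: rat list. 0 \<le> corr_form n f (\<lambda>i. of_rat (q ! i))" for f v
  proof -
    have "\<exists>r :: rat. v i - 1 / Suc m < of_rat r \<and> of_rat r < v i" for i m
      by (rule of_rat_dense) simp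
    then obtain r :: "nat \<Rightarrow> nat \<Rightarrow> rat"
      where r: "\<And>i m. v i - 1 / Suc m < of_rat (r i m)" "\<And>i m. of_rat (r i m) < v i"
      by metis
    have lim: "(\<lambda>m. real_of_rat (r i m)) \<longlonglongrightarrow> v i" for i
    proof (rule tendsto_sandwich[of "\<lambda>m. v i - 1 / Suc m" _ _ "\<lambda>_. v i"])
      have "(\<lambda>m. v i - 1 / real (Suc m)) \<longlonglongrightarrow> v i - 0"
        by (intro tendsto_diff tendsto_const LIMSEQ_Suc[OF lim_1_over_n])
      then show "(\<lambda>m. v i - 1 / real (Suc m)) \<longlonglongrightarrow> v i" by simp
    qed (use r in \<open>auto intro!: always_eventually less_imp_le simp del: of_nat_Suc\<close>)
    have "(\<lambda>m. corr_form n f (\<lambda>i. of_rat (r i m))) \<longlonglongrightarrow> corr_form n f v"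
      unfolding corr_form_def by (intro tendsto_intros lim)
    moreover have "0 \<le> corr_form n f (\<lambda>i. of_rat (r i m))" for m
    proof -
      have "corr_form n f (\<lambda>i. of_rat (r i m)) =
          corr_form n f (\<lambda>i. of_rat (map (\<lambda>i. r i m) [0..<n] ! i))"
        by (simp add: corr_form_def)
      then show ?thesis using q by simp
    qed
    ultimately show ?thesis by (intro LIMSEQ_le_const) auto
  qed
  then show ?thesis by (auto simp: corr_coords_def space_PiM PiE_def)
qed

lemma sets_corr_coords [measurable]: "corr_coords n \<in> sets (lebesgue_offdiag n)"
  unfolding corr_coords_rational corr_form_def by measurable

text \<open>In Gram vector terms, the substitution replaces \<open>v\<^sub>j\<close>, orthogonal to \<open>v\<^sub>i\<close>, by \<open>s v\<^sub>i + a v\<^sub>j\<close>.\<close>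

lemma corr_form_rotate:
  assumes ij: "i < n" "j < n" "i \<noteq> j" and sa: "s\<^sup>2 + a\<^sup>2 = 1"
    and orth: "corr_entry f i j = 0"
    and off: "\<And>k l. k < n \<Longrightarrow> l < n \<Longrightarrow> k \<noteq> j \<Longrightarrow> l \<noteq> j \<Longrightarrow> corr_entry g k l = corr_entry f k l"
    and row: "\<And>k. k < n \<Longrightarrow> k \<noteq> j \<Longrightarrow> corr_entry g k j = corr_entry f k i * s + a * corr_entry f k j"
  shows "corr_form n g v = corr_form n f (v(i := v i + s * v j, j := a * v j))"
proof -
  define N where "N = {..<n} - {j}"
  have N: "finite N" "j \<notin> N" "{..<n} = insert j N" "i \<in> N"
    using ij by (auto simp: N_def)
  \<comment> \<open>Separates the index \<open>j\<close>: its diagonal entry is 1, and by symmetry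
    the cross term occurs twice.\<close>
  have split: "corr_form n h u = (\<Sum>k\<in>N. \<Sum>l\<in>N. corr_entry h k l * u k * u l)
      + 2 * u j * (\<Sum>k\<in>N. corr_entry h k j * u k) + (u j)\<^sup>2" for h u
    unfolding corr_form_def N(3) using N(1,2)
    by (simp add: sum.distrib sum_distrib_left sum_distrib_right power2_eq_square algebra_simps
          corr_entry_commute[of h j])
  define w where "w = v(i := v i + s * v j, j := a * v j)"
  have w: "w k = v k + s * v j * (if k = i then 1 else 0)" if "k \<in> N" for k
    using that N(2) by (auto simp: w_def)
  have wj: "w j = a * v j" by (simp add: w_def)
  have "(\<Sum>k\<in>N. \<Sum>l\<in>N. corr_entry f k l * w k * w l) =
      (\<Sum>k\<in>N. \<Sum>l\<in>N. corr_entry f k l * v k * v l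
        + s * v j * (if l = i then corr_entry f k i * v k else 0)
        + s * v j * (if k = i then corr_entry f i l * v l else 0)
        + (s * v j)\<^sup>2 * (if k = i then if l = i then 1 else 0 else 0))"
    by (intro sum.cong refl) (auto simp: w algebra_simps power2_eq_square)
  also have "\<dots> = (\<Sum>k\<in>N. \<Sum>l\<in>N. corr_entry f k l * v k * v l)
      + 2 * s * v j * (\<Sum>k\<in>N. corr_entry f k i * v k) + (s * v j)\<^sup>2"
  proof -
    have "(\<Sum>k\<in>N. \<Sum>l\<in>N. if l = i then corr_entry f k i * v k else 0) = (\<Sum>k\<in>N. corr_entry f k i * v k)"
      using N(1,4) by simp
    moreover have "(\<Sum>k\<in>N. \<Sum>l\<in>N. if k = i then corr_entry f i l * v l else 0) = (\<Sum>k\<in>N. corr_entry f k i * v k)"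
      using N(1,4) by (subst sum.swap) (simp add: corr_entry_commute[of f i])
    moreover have "(\<Sum>k\<in>N. \<Sum>l\<in>N. if k = i then if l = i then 1 else 0 else 0) = (1 :: real)"
      using N(1,4) by (subst sum.swap) simp
    ultimately show ?thesis
      by (simp add: sum.distrib flip: sum_distrib_left)
  qed
  finally have 1: "(\<Sum>k\<in>N. \<Sum>l\<in>N. corr_entry f k l * w k * w l) =
    (\<Sum>k\<in>N. \<Sum>l\<in>N. corr_entry f k l * v k * v l)
      + 2 * s * v j * (\<Sum>k\<in>N. corr_entry f k i * v k) + (s * v j)\<^sup>2" .
  \<comment> \<open>On \<open>N\<close> the vector \<open>w\<close> differs from \<open>v\<close>
    only at \<open>i\<close>, where the coefficient \<open>corr_entry f i j\<close>
    vanishes.\<close>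
  have "(\<Sum>k\<in>N. corr_entry f k j * w k) = (\<Sum>k\<in>N. corr_entry f k j * v k)"
    using orth by (intro sum.cong refl) (auto simp: w)
  note 2 = this
  have "(\<Sum>k\<in>N. \<Sum>l\<in>N. corr_entry g k l * v k * v l) = (\<Sum>k\<in>N. \<Sum>l\<in>N. corr_entry f k l * v k * v l)"
    by (intro sum.cong refl) (auto simp: N_def off)
  moreover have "(\<Sum>k\<in>N. corr_entry g k j * v k) =
      s * (\<Sum>k\<in>N. corr_entry f k i * v k) + a * (\<Sum>k\<in>N. corr_entry f k j * v k)"
    unfolding sum_distrib_left sum.distrib[symmetric]
    by (intro sum.cong refl) (auto simp: N_def row algebra_simps)
  \<comment> \<open>Here \<open>s\<^sup>2 + a\<^sup>2 = 1\<close> enters: it keeps the diagonal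
    entry at \<open>j\<close> equal to 1.\<close>
  moreover have "(v j)\<^sup>2 = (s * v j)\<^sup>2 + (a * v j)\<^sup>2"
    using sa by (simp add: power_mult_distrib flip: distrib_right)
  ultimately show ?thesis
    unfolding split[of g v] split[of f w, folded w_def] w_def[symmetric] 1 2 wj
    by (simp add: algebra_simps)
qed

section \<open>Volume of slices in one row\<close>

text \<open>For \<open>a \<noteq> 0\<close> the substitution on vectors is invertible, so both forms
  take the same values and are nonnegative together.\<close>

lemma corr_coords_rotate:
  assumes ij: "i < n" "j < n" "i \<noteq> j" and sa: "s\<^sup>2 + a\<^sup>2 = 1" "a \<noteq> 0"
    and orth: "corr_entry f i j = 0"
    and off: "\<And>k l. k < n \<Longrightarrow> l < n \<Longrightarrow> k \<noteq> j \<Longrightarrow> l \<noteq> j \<Longrightarrow> corr_entry g k l = corr_entry f k l"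
    and row: "\<And>k. k < n \<Longrightarrow> k \<noteq> j \<Longrightarrow> corr_entry g k j = corr_entry f k i * s + a * corr_entry f k j"
    and ext: "f \<in> extensional (offdiag n)" "g \<in> extensional (offdiag n)"
  shows "g \<in> corr_coords n \<longleftrightarrow> f \<in> corr_coords n"
proof -
  have rot: "corr_form n g v = corr_form n f (v(i := v i + s * v j, j := a * v j))" for v
    by (rule corr_form_rotate[OF ij sa(1) orth]) (fact off, fact row)
  have "corr_form n f v = corr_form n g (v(i := v i - s * (v j / a), j := v j / a))" for v
  proof -
    define w where "w = v(i := v i - s * (v j / a), j := v j / a)"
    have "w(i := w i + s * w j, j := a * w j) = v"
      using ij(3) sa(2) by (auto simp: w_def fun_eq_iff)
    then show ?thesis using rot[of w] by (simp add: w_def)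
  qed
  then have "(\<forall>v. 0 \<le> corr_form n g v) \<longleftrightarrow> (\<forall>v. 0 \<le> corr_form n f v)"
    using rot by metis
  then show ?thesis
    using ext by (simp add: corr_coords_def)
qed

text \<open>Evaluating the form at \<open>e_i + c e_j\<close> with \<open>c = 1\<close> and
  \<open>c = -1\<close> gives \<open>2 + 2 C_ij \<ge> 0\<close> and
  \<open>2 - 2 C_ij \<ge> 0\<close>.\<close>

lemma corr_coords_entry_le_1:
  assumes f: "f \<in> corr_coords n" and ij: "i < n" "j < n" "i \<noteq> j"
  shows "\<bar>corr_entry f i j\<bar> \<le> 1"
proof -
  have form: "0 \<le> 1 + c\<^sup>2 + 2 * c * corr_entry f i j" for c
  proof -
    define v where "v = (\<lambda>k. if k = i then 1 else if k = j then c else 0)"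
    have "corr_form n f v = (\<Sum>k\<in>{i, j}. \<Sum>l<n. corr_entry f k l * v k * v l)"
      unfolding corr_form_def
      by (rule sum.mono_neutral_right) (use ij in \<open>auto simp: v_def\<close>)
    also have "\<dots> = (\<Sum>k\<in>{i, j}. \<Sum>l\<in>{i, j}. corr_entry f k l * v k * v l)"
      by (intro sum.cong refl sum.mono_neutral_right) (use ij in \<open>auto simp: v_def\<close>)
    also have "\<dots> = 1 + c\<^sup>2 + 2 * c * corr_entry f i j"
      using ij by (simp add: v_def corr_entry_commute[of f j i] power2_eq_square)
    finally show ?thesis
      using f by (auto simp: corr_coords_def dest: spec[of _ v])
  qed
  from form[of 1] form[of "-1"] show ?thesis by simp
qed

text \<open>Change of variables for a translation composed with scaling by \<open>a\<close>, whose
  Jacobian is \<open>a ^ card J\<close>. The induction splits off one coordinate and applies the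
  one-dimensional substitution.\<close>

lemma nn_integral_PiM_lborel_affine:
  fixes F :: "('i \<Rightarrow> real) \<Rightarrow> ennreal"
  assumes "finite J" and "0 < a" and "F \<in> borel_measurable (PiM J (\<lambda>_. lborel))"
  shows "(\<integral>\<^sup>+w. F w \<partial>PiM J (\<lambda>_. lborel)) =
    ennreal (a ^ card J) * (\<integral>\<^sup>+u. F (\<lambda>k\<in>J. t k + a * u k) \<partial>PiM J (\<lambda>_. lborel))"
  using assms(1,3)
proof (induction J arbitrary: F rule: finite_induct)
  case empty
  then show ?case by (simp add: PiM_empty nn_integral_count_space_finite restrict_def)
next
  case (insert p J)
  interpret product_sigma_finite "\<lambda>_::'i. lborel :: real measure" ..
  note [measurable] = insert.prems
  define G where "G = (\<lambda>x. \<integral>\<^sup>+y. F (x(p := t p + a * y)) \<partial>lborel)"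
  have [measurable]: "(\<lambda>(x, y). F (x(p := t p + a * y))) \<in> borel_measurable (PiM J (\<lambda>_. lborel) \<Otimes>\<^sub>M lborel)"
    by measurable
  have G [measurable]: "G \<in> borel_measurable (PiM J (\<lambda>_. lborel))"
    unfolding G_def by measurable
  have "(\<integral>\<^sup>+w. F w \<partial>PiM (insert p J) (\<lambda>_. lborel)) = (\<integral>\<^sup>+x. \<integral>\<^sup>+y. F (x(p := y)) \<partial>lborel \<partial>PiM J (\<lambda>_. lborel))"
    using insert.hyps by (intro product_nn_integral_insert) auto
  also have "\<dots> = (\<integral>\<^sup>+x. ennreal a * G x \<partial>PiM J (\<lambda>_. lborel))"
  proof (rule nn_integral_cong)
    fix x assume "x \<in> space (PiM J (\<lambda>_. lborel :: real measure))"
    then have "(\<lambda>y. F (x(p := y))) \<in> borel_measurable borel"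
      by measurable
    then show "(\<integral>\<^sup>+y. F (x(p := y)) \<partial>lborel) = ennreal a * G x"
      using \<open>0 < a\<close> unfolding G_def by (subst nn_integral_real_affine[where c = a and t = "t p"]) auto
  qed
  also have "\<dots> = ennreal a * (\<integral>\<^sup>+x. G x \<partial>PiM J (\<lambda>_. lborel))"
    by (simp add: nn_integral_cmult)
  also have "\<dots> = ennreal (a ^ card (insert p J)) * (\<integral>\<^sup>+u. G (\<lambda>k\<in>J. t k + a * u k) \<partial>PiM J (\<lambda>_. lborel))"
    unfolding insert.IH[OF G] using insert.hyps \<open>0 < a\<close> by (simp add: ennreal_mult mult.assoc)
  also have "(\<integral>\<^sup>+u. G (\<lambda>k\<in>J. t k + a * u k) \<partial>PiM J (\<lambda>_. lborel)) =
      (\<integral>\<^sup>+u. \<integral>\<^sup>+y. F (\<lambda>k\<in>insert p J. t k + a * (u(p := y)) k) \<partial>lborel \<partial>PiM J (\<lambda>_. lborel))"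
    unfolding G_def using insert.hyps
    by (intro nn_integral_cong arg_cong[of _ _ F]) (auto simp: fun_eq_iff)
  also have "\<dots> = (\<integral>\<^sup>+u. F (\<lambda>k\<in>insert p J. t k + a * u k) \<partial>PiM (insert p J) (\<lambda>_. lborel))"
    using insert.hyps by (subst product_nn_integral_insert) auto
  finally show ?case .
qed

text \<open>The unnormalised law of one entry. The density is the Jacobian of the row substitution:
  scaling by \<open>sqrt (1 - s\<^sup>2)\<close> in the \<open>n - 2\<close> other entries of the
  row.\<close>

definition entry_measure :: "nat \<Rightarrow> real measure" where
  "entry_measure n = density lborel (\<lambda>s. ennreal (indicator {-1<..<1} s * sqrt (1 - s\<^sup>2) ^ (n - 2)))"

text \<open>Encodes "determined by the entries that avoid row and column \<open>j\<close>" as an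
  invariance, which is easy to check for concrete events. One implication suffices, since
  \<open>f\<close> and \<open>g\<close> can be exchanged.\<close>

definition off_index :: "nat \<Rightarrow> nat \<Rightarrow> (nat \<times> nat \<Rightarrow> real) set \<Rightarrow> bool" where
  "off_index n j A \<longleftrightarrow> A \<in> sets (lebesgue_offdiag n) \<and>
    (\<forall>f\<in>space (lebesgue_offdiag n). \<forall>g\<in>space (lebesgue_offdiag n).
      (\<forall>k<n. \<forall>l<n. k \<noteq> j \<longrightarrow> l \<noteq> j \<longrightarrow> corr_entry f k l = corr_entry g k l) \<longrightarrow> f \<in> A \<longrightarrow> g \<in> A)"

text \<open>Fubini with the other entries of row \<open>j\<close> innermost. For fixed
  \<open>s\<close> the affine substitution carries the slice at \<open>s\<close> to the slice at 0
  and contributes the Jacobian, while \<open>A\<close> does not see row \<open>j\<close>. So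
  \<open>c\<close> is the volume of the slice of \<open>corr_coords n \<inter> A\<close> at 0, the
  same for every \<open>S\<close>.\<close>

lemma emeasure_corr_coords_factor:
  assumes ij: "i < n" "j < n" "i \<noteq> j" and A: "off_index n j A"
  obtains c where "\<And>S. S \<in> sets borel \<Longrightarrow>
    emeasure (lebesgue_offdiag n) (corr_coords n \<inter> (A \<inter> {f \<in> space (lebesgue_offdiag n). corr_entry f i j \<in> S}))
      = c * emeasure (entry_measure n) S"
proof
  interpret product_sigma_finite "\<lambda>_::nat \<times> nat. lborel :: real measure" ..
  \<comment> \<open>\<open>pr k\<close> is the coordinate of the pair of \<open>k\<close> and
    \<open>j\<close>, and \<open>oth\<close> recovers \<open>k\<close> from it. \<open>J\<close>
    holds the remaining positions of row \<open>j\<close>, and \<open>I\<close> those avoiding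
    \<open>j\<close>.\<close>
  define pr where "pr = (\<lambda>k. (min k j, max k j))"
  define J where "J = pr ` ({..<n} - {i, j})"
  define I where "I = offdiag n - J - {pr i}"
  define oth where "oth = (\<lambda>p. if fst p = j then snd p else fst p)"
  have oth: "oth (pr k) = k" for k
    by (auto simp: oth_def pr_def min_def max_def)
  have inj: "inj pr" by (rule inj_on_inverseI[of _ oth]) (simp add: oth)
  have J_sub: "J \<subseteq> offdiag n" and pri: "pr i \<in> offdiag n" "pr i \<notin> J"
  proof -
    show "J \<subseteq> offdiag n" "pr i \<in> offdiag n"
      using ij by (auto simp: J_def pr_def intro!: min_max_in_offdiag)
    show "pr i \<notin> J"
      using inj by (auto simp: J_def dest: injD)
  qed
  have IJ: "insert (pr i) I \<union> J = offdiag n" "insert (pr i) I \<inter> J = {}" "pr i \<notin> I"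
    using J_sub pri by (auto simp: I_def)
  have fin: "finite I" "finite J" by (auto simp: I_def J_def)
  interpret PJ: finite_product_sigma_finite "\<lambda>_::nat \<times> nat. lborel :: real measure" J
    by standard (rule fin)
  have cardJ: "card J = n - 2"
    using ij inj by (simp add: J_def card_image inj_on_subset card_Diff_subset)
  \<comment> \<open>Assembles a point from the entries \<open>z\<close> away from \<open>j\<close>,
    the value \<open>s\<close> at the pair of \<open>i\<close> and \<open>j\<close>, and the rest
    \<open>w\<close> of row \<open>j\<close>.\<close>
  define mg where "mg = (\<lambda>z s (w :: nat \<times> nat \<Rightarrow> real). merge (insert (pr i) I) J (z(pr i := s), w))"
  have mg_off: "corr_entry (mg z s w) k l = corr_entry z k l" if "k < n" "l < n" "k \<noteq> j" "l \<noteq> j" for z s w k l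
  proof (cases "k = l")
    case False
    have "(min k l, max k l) \<noteq> pr m" for m
      using that by (auto simp: pr_def min_def max_def split: if_splits)
    then have "(min k l, max k l) \<in> I"
      using min_max_in_offdiag[OF that(1,2) False] by (auto simp: I_def J_def)
    then show ?thesis
      using IJ False by (auto simp: mg_def corr_entry_def merge_def)
  qed simp
  have mg_i: "corr_entry (mg z s w) i j = s" for z s w
    using ij IJ by (simp add: mg_def corr_entry_def merge_def pr_def)
  have mg_row: "corr_entry (mg z s w) k j = w (pr k)" if "k < n" "k \<noteq> i" "k \<noteq> j" for z s w k
  proof -
    have "pr k \<in> J" using that by (auto simp: J_def)
    then show ?thesis
      using that IJ by (auto simp: mg_def corr_entry_def merge_def pr_def)
  qed
  have mg_ext: "mg z s w \<in> extensional (offdiag n)" for z s w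
    unfolding mg_def IJ(1)[symmetric] by (rule extensional_merge)
  have space_ext: "space (lebesgue_offdiag n) = extensional (offdiag n)"
    by (auto simp: space_PiM PiE_def)
  have A_iff: "mg z s w \<in> A \<longleftrightarrow> mg z s' w' \<in> A" for z s w s' w'
  proof -
    have *: "\<And>f g. f\<in>extensional (offdiag n) \<Longrightarrow> g \<in>extensional (offdiag n) \<Longrightarrow>
      (\<forall>k<n. \<forall>l<n. k \<noteq> j \<longrightarrow> l \<noteq> j \<longrightarrow> corr_entry f k l = corr_entry g k l) \<Longrightarrow> f \<in> A \<Longrightarrow> g \<in> A"
      using A unfolding off_index_def space_ext by blast
    show ?thesis
      by (intro iffI; erule *[rotated 3]) (auto simp: mg_ext mg_off)
  qed
  \<comment> \<open>The Gram vector substitution in coordinates, with \<open>s\<close> and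
    \<open>a = sqrt (1 - s\<^sup>2)\<close>.\<close>
  have rot: "mg z s (\<lambda>p\<in>J. corr_entry z (oth p) i * s + sqrt (1 - s\<^sup>2) * u p) \<in> corr_coords n \<longleftrightarrow>
      mg z 0 u \<in> corr_coords n" if "\<bar>s\<bar> < 1" for z s u
  proof (rule corr_coords_rotate[OF ij])
    have "s\<^sup>2 < 1" using that by (simp add: abs_square_less_1)
    then show "s\<^sup>2 + (sqrt (1 - s\<^sup>2))\<^sup>2 = 1" "sqrt (1 - s\<^sup>2) \<noteq> 0" by simp_all
    fix k assume k: "k < n" "k \<noteq> j"
    show "corr_entry (mg z s (\<lambda>p\<in>J. corr_entry z (oth p) i * s + sqrt (1 - s\<^sup>2) * u p)) k j =
      corr_entry (mg z 0 u) k i * s + sqrt (1 - s\<^sup>2) * corr_entry (mg z 0 u) k j"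
    proof (cases "k = i")
      case False
      then have "pr k \<in> J" using k by (auto simp: J_def)
      then show ?thesis using k False ij by (simp add: mg_row mg_off oth)
    qed (simp add: mg_i)
  qed (auto simp: mg_i mg_off mg_ext)
  define E where "E = corr_coords n \<inter> A"
  have [measurable]: "A \<in> sets (lebesgue_offdiag n)" using A by (simp add: off_index_def)
  have E [measurable]: "E \<in> sets (lebesgue_offdiag n)" unfolding E_def by measurable
  define c where "c = (\<integral>\<^sup>+z. \<integral>\<^sup>+u. indicator E (mg z 0 u) \<partial>PiM J (\<lambda>_. lborel) \<partial>PiM I (\<lambda>_. lborel))"
  fix S :: "real set" assume [measurable]: "S \<in> sets borel"
  have [measurable]: "(\<lambda>f. corr_entry f i j) \<in> borel_measurable (lebesgue_offdiag n)"
    using ij by simp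
  define X where "X = corr_coords n \<inter> (A \<inter> {f \<in> space (lebesgue_offdiag n). corr_entry f i j \<in> S})"
  have X [measurable]: "X \<in> sets (lebesgue_offdiag n)" unfolding X_def by measurable
  have X_mg: "indicator X (mg z s w) = (indicator E (mg z s w) * indicator S s :: ennreal)" for z s w
    using mg_ext by (auto simp: X_def E_def mg_i space_ext split: split_indicator)
  have meas3: "(\<lambda>x. mg (fst (fst x)) (snd (fst x)) (snd x)) \<in> measurable ((PiM I (\<lambda>_. lborel) \<Otimes>\<^sub>M lborel) \<Otimes>\<^sub>M PiM J (\<lambda>_. lborel)) (lebesgue_offdiag n)"
    unfolding mg_def IJ(1)[symmetric] by measurable
  have meas_w [measurable]: "(\<lambda>w. mg z s w) \<in> measurable (PiM J (\<lambda>_. lborel)) (lebesgue_offdiag n)"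
    if "z \<in> space (PiM I (\<lambda>_. lborel))" for z s
    using measurable_compose[OF measurable_Pair1' meas3, of "(z, s)"] that by (simp add: space_pair_measure)
  \<comment> \<open>For \<open>\<bar>s\<bar> > 1\<close> the slice is empty, and for
    \<open>\<bar>s\<bar> < 1\<close> the substitution applies. At \<open>\<bar>s\<bar> = 1\<close>
    the scaling degenerates, but these two values form a null set.\<close>
  have inner: "(\<integral>\<^sup>+w. indicator X (mg z s w) \<partial>PiM J (\<lambda>_. lborel)) =
      (\<integral>\<^sup>+u. indicator E (mg z 0 u) \<partial>PiM J (\<lambda>_. lborel)) *
       (ennreal (indicator {-1<..<1} s * sqrt (1 - s\<^sup>2) ^ (n - 2)) * indicator S s)"
    if z: "z \<in> space (PiM I (\<lambda>_. lborel))" and s: "\<bar>s\<bar> \<noteq> 1" for z s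
  proof (cases "\<bar>s\<bar> < 1")
    case False
    then have "mg z s w \<notin> corr_coords n" for w
      using corr_coords_entry_le_1[OF _ ij] mg_i s by force
    then have "indicator X (mg z s w) = (0 :: ennreal)" for w by (simp add: X_def)
    moreover have "s \<notin> {-1<..<1}" using False by auto
    ultimately show ?thesis by simp
  next
    case True
    define a where "a = sqrt (1 - s\<^sup>2)"
    have "s\<^sup>2 < 1" using True by (simp add: abs_square_less_1)
    then have a: "0 < a" by (simp add: a_def)
    have "(\<integral>\<^sup>+w. indicator X (mg z s w) \<partial>PiM J (\<lambda>_. lborel)) =
        (\<integral>\<^sup>+w. indicator E (mg z s w) \<partial>PiM J (\<lambda>_. lborel)) * indicator S s"
      unfolding X_mg using z by (intro nn_integral_multc) measurable
    also have "(\<integral>\<^sup>+w. indicator E (mg z s w) \<partial>PiM J (\<lambda>_. lborel)) = ennreal (a ^ card J) *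
        (\<integral>\<^sup>+u. indicator E (mg z s (\<lambda>p\<in>J. corr_entry z (oth p) i * s + a * u p)) \<partial>PiM J (\<lambda>_. lborel))"
      using z by (intro nn_integral_PiM_lborel_affine[OF fin(2) a]) measurable
    also have "\<dots> = ennreal (a ^ card J) * (\<integral>\<^sup>+u. indicator E (mg z 0 u) \<partial>PiM J (\<lambda>_. lborel))"
    proof -
      have "mg z s (\<lambda>p\<in>J. corr_entry z (oth p) i * s + a * u p) \<in> E \<longleftrightarrow> mg z 0 u \<in> E" for u
        unfolding E_def a_def Int_iff rot[OF True] using A_iff by blast
      then show ?thesis by (simp add: indicator_def)
    qed
    finally show ?thesis
      using True by (simp add: cardJ a_def mult_ac abs_less_iff indicator_def[of "{-1<..<1}"])
  qed
  have ae: "AE s in lborel. \<bar>s :: real\<bar> \<noteq> 1"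
    using AE_lborel_singleton[of 1] AE_lborel_singleton[of "-1"] by eventually_elim auto
  have meas_c [measurable]: "(\<lambda>z. \<integral>\<^sup>+u. indicator E (mg z 0 u) \<partial>PiM J (\<lambda>_. lborel)) \<in> borel_measurable (PiM I (\<lambda>_. lborel))"
  proof -
    have "(\<lambda>(z, u). mg z 0 u) \<in> measurable (PiM I (\<lambda>_. lborel) \<Otimes>\<^sub>M PiM J (\<lambda>_. lborel)) (lebesgue_offdiag n)"
      unfolding mg_def IJ(1)[symmetric] by measurable
    then have "(\<lambda>(z, u). indicator E (mg z 0 u) :: ennreal) \<in>
        borel_measurable (PiM I (\<lambda>_. lborel) \<Otimes>\<^sub>M PiM J (\<lambda>_. lborel))"
      using E by measurable
    then show ?thesis
      by (rule PJ.borel_measurable_nn_integral)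
  qed
  have "emeasure (lebesgue_offdiag n) X = (\<integral>\<^sup>+f. indicator X f \<partial>PiM (insert (pr i) I \<union> J) (\<lambda>_. lborel))"
    unfolding IJ(1) by simp
  also have "\<dots> = (\<integral>\<^sup>+y. \<integral>\<^sup>+w. indicator X (merge (insert (pr i) I) J (y, w)) \<partial>PiM J (\<lambda>_. lborel) \<partial>PiM (insert (pr i) I) (\<lambda>_. lborel))"
    using IJ(2) fin by (intro product_nn_integral_fold) (simp_all only: IJ(1) finite.insertI, measurable)
  also have "\<dots> = (\<integral>\<^sup>+z. \<integral>\<^sup>+s. \<integral>\<^sup>+w. indicator X (mg z s w) \<partial>PiM J (\<lambda>_. lborel) \<partial>lborel \<partial>PiM I (\<lambda>_. lborel))"
    unfolding mg_def
  proof (intro product_nn_integral_insert)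
    have X' [measurable]: "X \<in> sets (PiM (insert (pr i) I \<union> J) (\<lambda>_. lborel))"
      unfolding IJ(1) by (rule X)
    have "(\<lambda>(y, w). indicator X (merge (insert (pr i) I) J (y, w)) :: ennreal) \<in>
        borel_measurable (PiM (insert (pr i) I) (\<lambda>_. lborel) \<Otimes>\<^sub>M PiM J (\<lambda>_. lborel))"
      unfolding case_prod_beta' prod.collapse
      by (rule measurable_compose[OF measurable_merge borel_measurable_indicator[OF X']])
    then show "(\<lambda>y. \<integral>\<^sup>+ w. indicator X (merge (insert (pr i) I) J (y, w)) \<partial>PiM J (\<lambda>_. lborel))
      \<in> borel_measurable (PiM (insert (pr i) I) (\<lambda>_. lborel))"
      by (rule PJ.borel_measurable_nn_integral)
  qed (use IJ fin in auto)
  also have "\<dots> = (\<integral>\<^sup>+z. (\<integral>\<^sup>+u. indicator E (mg z 0 u) \<partial>PiM J (\<lambda>_. lborel)) * emeasure (entry_measure n) S \<partial>PiM I (\<lambda>_. lborel))"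
  proof (intro nn_integral_cong)
    fix z assume z: "z \<in> space (PiM I (\<lambda>_. lborel :: real measure))"
    have "(\<integral>\<^sup>+s. \<integral>\<^sup>+w. indicator X (mg z s w) \<partial>PiM J (\<lambda>_. lborel) \<partial>lborel) =
      (\<integral>\<^sup>+s. (\<integral>\<^sup>+u. indicator E (mg z 0 u) \<partial>PiM J (\<lambda>_. lborel)) *
       (ennreal (indicator {-1<..<1} s * sqrt (1 - s\<^sup>2) ^ (n - 2)) * indicator S s) \<partial>lborel)"
      by (intro nn_integral_cong_AE eventually_mono[OF ae] inner z)
    also have "\<dots> = (\<integral>\<^sup>+u. indicator E (mg z 0 u) \<partial>PiM J (\<lambda>_. lborel)) * emeasure (entry_measure n) S"
      by (subst nn_integral_cmult) (auto simp: entry_measure_def emeasure_density)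
    finally show "(\<integral>\<^sup>+s. \<integral>\<^sup>+w. indicator X (mg z s w) \<partial>PiM J (\<lambda>_. lborel) \<partial>lborel) =
      (\<integral>\<^sup>+u. indicator E (mg z 0 u) \<partial>PiM J (\<lambda>_. lborel)) * emeasure (entry_measure n) S" .
  qed
  also have "\<dots> = c * emeasure (entry_measure n) S"
    unfolding c_def by (intro nn_integral_multc) measurable
  finally show "emeasure (lebesgue_offdiag n) (corr_coords n \<inter> (A \<inter> {f \<in> space (lebesgue_offdiag n). corr_entry f i j \<in> S}))
      = c * emeasure (entry_measure n) S"
    unfolding X_def .
qed

section \<open>Independence and the recursion over rows\<close>

abbreviation corr_law :: "nat \<Rightarrow> (nat \<times> nat \<Rightarrow> real) measure" where
  "corr_law n \<equiv> uniform_measure (lebesgue_offdiag n) (corr_coords n)"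

definition entry_prob :: "nat \<Rightarrow> real set \<Rightarrow> real" where
  "entry_prob n S = measure (entry_measure n) S / measure (entry_measure n) UNIV"

lemma off_index_space: "off_index n j (space (lebesgue_offdiag n))"
  by (simp add: off_index_def)

text \<open>The factorisation is applied with \<open>S\<close> and with \<open>UNIV\<close>; the
  unknown constant, which depends on \<open>A\<close> only, cancels in the quotient.\<close>

lemma corr_law_entry_indep:
  assumes prob: "prob_space (corr_law n)" and ij: "i < n" "j < n" "i \<noteq> j"
    and A: "off_index n j A" and S: "S \<in> sets borel"
  shows "measure (corr_law n) (A \<inter> {f \<in> space (lebesgue_offdiag n). corr_entry f i j \<in> S})
    = measure (corr_law n) A * entry_prob n S"
proof -
  let ?M = "lebesgue_offdiag n" and ?E = "corr_coords n"
  let ?H = "measure (entry_measure n)"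
  have "emeasure (corr_law n) (space ?M) = 1"
    using prob_space.emeasure_space_1[OF prob] by simp
  moreover have "emeasure (corr_law n) (space ?M) = emeasure ?M ?E / emeasure ?M ?E"
    using sets.sets_into_space[OF sets_corr_coords] by (simp add: Int_absorb2)
  \<comment> \<open>In \<open>ennreal\<close> both \<open>0 / 0\<close> and
    \<open>\<infinity> / \<infinity>\<close> are 0, so total mass 1 forces the volume to be positive
    and finite.\<close>
  ultimately have quot: "emeasure ?M ?E / emeasure ?M ?E = 1"
    by simp
  have E0: "emeasure ?M ?E \<noteq> 0"
    using quot by (intro notI) simp
  have Einf: "emeasure ?M ?E \<noteq> \<infinity>"
    using quot by (intro notI) simp
  have factor: "\<exists>c. \<forall>S\<in>sets borel. measure ?M (?E \<inter> (B \<inter> {f \<in> space ?M. corr_entry f i j \<in> S})) = c * ?H S"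
    if B: "off_index n j B" for B
  proof -
    from emeasure_corr_coords_factor[OF ij B] obtain c where
      "\<And>S. S \<in> sets borel \<Longrightarrow> emeasure ?M (?E \<inter> (B \<inter> {f \<in> space ?M. corr_entry f i j \<in> S}))
        = c * emeasure (entry_measure n) S" by blast
    then show ?thesis
      by (intro exI[of _ "enn2real c"]) (simp add: measure_def enn2real_mult)
  qed
  have [measurable]: "(\<lambda>f. corr_entry f i j) \<in> borel_measurable ?M"
    using ij by simp
  have As [measurable]: "A \<in> sets ?M" using A by (simp add: off_index_def)
  note [measurable] = S
  \<comment> \<open>The case of the whole space shows that the normalising mass
    \<open>?H UNIV\<close> is nonzero.\<close>
  obtain c0 where "measure ?M (?E \<inter> (space ?M \<inter> {f \<in> space ?M. corr_entry f i j \<in> UNIV})) = c0 * ?H UNIV"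
    using factor[OF off_index_space] sets.top[of borel] unfolding space_borel by blast
  then have "measure ?M ?E = c0 * ?H UNIV"
    using sets.sets_into_space[OF sets_corr_coords] by (simp add: Int_absorb2)
  moreover have "measure ?M ?E \<noteq> 0"
    using E0 Einf by (simp add: measure_def enn2real_eq_0_iff)
  ultimately have H: "?H UNIV \<noteq> 0" by auto
  obtain c where c: "\<And>S. S \<in> sets borel \<Longrightarrow> measure ?M (?E \<inter> (A \<inter> {f \<in> space ?M. corr_entry f i j \<in> S})) = c * ?H S"
    using factor[OF A] by blast
  have "A \<inter> {f \<in> space ?M. corr_entry f i j \<in> UNIV} = A"
    using sets.sets_into_space[OF As] by auto
  with c[of UNIV] have cA: "measure ?M (?E \<inter> A) = c * ?H UNIV" by simp
  have "A \<inter> {f \<in> space ?M. corr_entry f i j \<in> S} \<in> sets ?M" by measurable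
  then show ?thesis
    using c[OF S] cA H As
    by (simp add: measure_uniform_measure[OF E0 Einf] entry_prob_def)
qed

lemma corr_law_entry:
  assumes "prob_space (corr_law n)" and "i < n" "j < n" "i \<noteq> j" and "S \<in> sets borel"
  shows "measure (corr_law n) {f \<in> space (lebesgue_offdiag n). corr_entry f i j \<in> S} = entry_prob n S"
  using corr_law_entry_indep[OF assms(1-4) off_index_space assms(5)] prob_space.prob_space[OF assms(1)]
  by (simp add: Int_absorb1)

text \<open>By induction: joining \<open>G k\<close> adds its measure minus its overlap with the
  earlier union, and subadditivity bounds that overlap by the pairwise intersections.\<close>

lemma (in finite_measure) Bonferroni_lower:
  fixes k :: nat
  assumes "\<And>i. i < k \<Longrightarrow> G i \<in> sets M"
  shows "(\<Sum>i<k. measure M (G i)) - (\<Sum>i<k. \<Sum>j<i. measure M (G i \<inter> G j)) \<le> measure M (\<Union>i<k. G i)"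
  using assms
proof (induction k)
  case (Suc k)
  have U: "(\<Union>i<k. G i) \<in> sets M" using Suc.prems by auto
  have "measure M ((\<Union>i<k. G i) \<inter> G k) = measure M (\<Union>j<k. G k \<inter> G j)"
    by (rule arg_cong[of _ _ "measure M"]) auto
  also have "\<dots> \<le> (\<Sum>j<k. measure M (G k \<inter> G j))"
    using Suc.prems by (intro finite_measure_subadditive_finite) auto
  finally have "measure M ((\<Union>i<k. G i) \<inter> G k) \<le> (\<Sum>j<k. measure M (G k \<inter> G j))" .
  moreover have "measure M (\<Union>i<Suc k. G i) =
      measure M (\<Union>i<k. G i) + measure M (G k) - measure M ((\<Union>i<k. G i) \<inter> G k)"
    using measure_Un3[of "\<Union>i<k. G i" M "G k"] U Suc.prems
    by (simp add: lessThan_Suc Un_commute fmeasurable_eq_sets)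
  ultimately show ?case using Suc by simp
qed simp

section \<open>The recursion over rows and its limit\<close>

definition bounded_corner :: "nat \<Rightarrow> real \<Rightarrow> nat \<Rightarrow> (nat \<times> nat \<Rightarrow> real) set" where
  "bounded_corner n x k = {f \<in> space (lebesgue_offdiag n). \<forall>l<k. \<forall>m<l. \<bar>corr_entry f m l\<bar> \<le> x}"

text \<open>The excluded events are cut down to the old corner, so that the measure of the
  difference is a difference of measures.\<close>

lemma bounded_corner_Suc:
  "bounded_corner n x (Suc k) = bounded_corner n x k -
     (\<Union>i<k. bounded_corner n x k \<inter> {f \<in> space (lebesgue_offdiag n). corr_entry f i k \<in> {s. \<bar>s\<bar> > x}})"
  by (auto simp: bounded_corner_def less_Suc_eq not_less) (meson leD)

lemma sets_bounded_corner: "k \<le> n \<Longrightarrow> bounded_corner n x k \<in> sets (lebesgue_offdiag n)"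
proof (induction k)
  case 0
  have "bounded_corner n x 0 = space (lebesgue_offdiag n)" by (auto simp: bounded_corner_def)
  then show ?case by simp
next
  case (Suc k)
  have "{f \<in> space (lebesgue_offdiag n). corr_entry f i k \<in> {s. \<bar>s\<bar> > x}} \<in> sets (lebesgue_offdiag n)" if "i < k" for i
  proof -
    have [measurable]: "(\<lambda>f. corr_entry f i k) \<in> borel_measurable (lebesgue_offdiag n)"
      using Suc.prems that by simp
    show ?thesis by measurable
  qed
  then show ?case
    using Suc unfolding bounded_corner_Suc by (intro sets.Diff sets.finite_UN sets.Int) auto
qed

lemma off_index_bounded_corner:
  assumes "k < n"
  shows "off_index n k (bounded_corner n x k)"
  unfolding off_index_def
proof (intro conjI ballI impI)
  fix f g assume "g \<in> space (lebesgue_offdiag n)" "f \<in> bounded_corner n x k"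
    and *: "\<forall>i<n. \<forall>l<n. i \<noteq> k \<longrightarrow> l \<noteq> k \<longrightarrow> corr_entry f i l = corr_entry g i l"
  moreover have "corr_entry f m l = corr_entry g m l" if "l < k" "m < l" for l m
    using that assms by (intro *[rule_format]) auto
  ultimately show "g \<in> bounded_corner n x k"
    by (simp add: bounded_corner_def)
qed (use assms in \<open>simp add: sets_bounded_corner\<close>)

text \<open>The old corner avoids index \<open>k\<close>, so it is independent of each single new
  entry and the first-order sum is exactly \<open>k p d_k\<close>. The union bound gives the lower
  estimate; Bonferroni gives the upper one, with an error from fewer than \<open>k\<^sup>2\<close>
  pairs when \<open>k > 0\<close>.\<close>

lemma bounded_corner_step:
  fixes n x
  defines "p \<equiv> entry_prob n {s. \<bar>s\<bar> > x}"
  defines "d \<equiv> \<lambda>k. measure (corr_law n) (bounded_corner n x k)"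
  assumes prob: "prob_space (corr_law n)" and k: "k < n"
  shows "d k * (1 - k * p) \<le> d (Suc k)" "d (Suc k) \<le> d k * (1 - k * p) + (real k)\<^sup>2 * p\<^sup>2"
proof -
  interpret prob_space "corr_law n" by (rule prob)
  define B where "B = (\<lambda>i l. {f \<in> space (lebesgue_offdiag n). corr_entry f i l \<in> {s. \<bar>s\<bar> > x}})"
  define D where "D = bounded_corner n x k"
  have S: "{s::real. \<bar>s\<bar> > x} \<in> sets borel" by measurable
  have Ds: "D \<in> sets (lebesgue_offdiag n)" using k by (simp add: D_def sets_bounded_corner)
  have Bs: "B i l \<in> sets (lebesgue_offdiag n)" if "i < n" "l < n" for i l
  proof -
    have [measurable]: "(\<lambda>f. corr_entry f i l) \<in> borel_measurable (lebesgue_offdiag n)"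
      using that by simp
    show ?thesis unfolding B_def by measurable
  qed
  have DB: "prob (D \<inter> B i k) = prob D * p" if "i < k" for i
    unfolding D_def B_def p_def using that k
    by (intro corr_law_entry_indep[OF prob _ _ _ off_index_bounded_corner S]) auto
  \<comment> \<open>The entry at \<open>i\<close> and \<open>k\<close> avoids index
    \<open>j\<close>, so it is independent of the entry at \<open>k\<close> and \<open>j\<close>,
    read as lying in row \<open>j\<close>.\<close>
  have BB: "prob (B i k \<inter> B j k) = p\<^sup>2" if "i < k" "j < i" for i j
  proof -
    have "off_index n j (B i k)"
      using that k Bs[of i k] by (auto simp: off_index_def B_def)
    then have "prob (B i k \<inter> B k j) = prob (B i k) * p"
      unfolding B_def[of] p_def using that k
      by (intro corr_law_entry_indep[OF prob _ _ _ _ S]) (auto simp: B_def)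
    moreover have "prob (B i k) = p"
      unfolding B_def p_def using that k by (intro corr_law_entry[OF prob _ _ _ S]) auto
    moreover have "B k j = B j k" by (simp add: B_def corr_entry_commute)
    ultimately show ?thesis by (simp add: power2_eq_square)
  qed
  have "d (Suc k) = prob D - prob (\<Union>i<k. D \<inter> B i k)"
    unfolding d_def bounded_corner_Suc D_def[symmetric]
    unfolding B_def[THEN fun_cong, THEN fun_cong, symmetric]
    using k Ds Bs by (intro finite_measure_Diff) auto
  moreover have "prob (\<Union>i<k. D \<inter> B i k) \<le> (\<Sum>i<k. prob (D \<inter> B i k))"
    using k Ds Bs by (intro finite_measure_subadditive_finite) auto
  moreover have "(\<Sum>i<k. prob (D \<inter> B i k)) = k * p * prob D"
    by (simp add: DB)
  moreover have "(\<Sum>i<k. prob (D \<inter> B i k)) - (\<Sum>i<k. \<Sum>j<i. prob ((D \<inter> B i k) \<inter> (D \<inter> B j k))) \<le> prob (\<Union>i<k. D \<inter> B i k)"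
    using k Ds Bs by (intro Bonferroni_lower) auto
  moreover have "(\<Sum>i<k. \<Sum>j<i. prob ((D \<inter> B i k) \<inter> (D \<inter> B j k))) \<le> (real k)\<^sup>2 * p\<^sup>2"
  proof -
    \<comment> \<open>The corner \<open>D\<close> is dropped here, as independence is known only for
      pairs of entries.\<close>
    have "(\<Sum>i<k. \<Sum>j<i. prob ((D \<inter> B i k) \<inter> (D \<inter> B j k))) \<le> (\<Sum>i<k. \<Sum>j<i. p\<^sup>2)"
    proof (intro sum_mono)
      fix i j assume "i \<in> {..<k}" "j \<in> {..<i}"
      then show "prob ((D \<inter> B i k) \<inter> (D \<inter> B j k)) \<le> p\<^sup>2"
        using k Bs by (subst BB[symmetric, of i j]) (auto intro!: finite_measure_mono)
    qed
    also have "\<dots> \<le> (\<Sum>i<k. k * p\<^sup>2)"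
      by (intro sum_mono) (auto intro!: mult_right_mono)
    finally show ?thesis by (simp add: power2_eq_square mult.assoc)
  qed
  ultimately show "d k * (1 - k * p) \<le> d (Suc k)" "d (Suc k) \<le> d k * (1 - k * p) + (real k)\<^sup>2 * p\<^sup>2"
    by (simp_all add: d_def D_def algebra_simps)
qed

text \<open>The product of the factors \<open>1 - k p\<close> is compared with the exponential of
  \<open>- p n (n - 1) / 2\<close>, the sum of the terms \<open>- k p\<close>.\<close>

lemma product_recursion_bounds:
  fixes d :: "nat \<Rightarrow> real" and p :: real
  assumes d0: "d 0 = 1" and p: "0 \<le> p" "n * p \<le> 1 / 2"
    and lower: "\<And>k. k < n \<Longrightarrow> d k * (1 - k * p) \<le> d (Suc k)"
    and upper: "\<And>k. k < n \<Longrightarrow> d (Suc k) \<le> d k * (1 - k * p) + (real k)\<^sup>2 * p\<^sup>2"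
  shows "exp (- p * (n * (real n - 1) / 2) - 2 * p\<^sup>2 * real n ^ 3) \<le> d n"
    and "d n \<le> exp (- p * (n * (real n - 1) / 2)) + p\<^sup>2 * real n ^ 3"
proof -
  have kp: "k * p \<le> 1 / 2" if "k < n" for k :: nat
    using that p mult_right_mono[of k n p] by simp
  \<comment> \<open>From \<open>ln (1 - y) \<ge> - y - 2 y\<^sup>2\<close> for
    \<open>0 \<le> y \<le> 1/2\<close>. Bounding \<open>k\<close> by \<open>n\<close> in the
    quadratic term gives the same error in each step, hence \<open>n ^ 3\<close> in total.\<close>
  have "exp (- p * (k * (real k - 1) / 2) - 2 * p\<^sup>2 * k * (real n)\<^sup>2) \<le> d k" if "k \<le> n" for k
    using that
  proof (induction k)
    case (Suc k)
    have "- (k * p) - 2 * (k * p)\<^sup>2 \<le> ln (1 - k * p)"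
      using kp[of k] Suc.prems p by (intro ln_one_minus_pos_lower_bound) auto
    then have "exp (- (k * p) - 2 * (k * p)\<^sup>2) \<le> 1 - k * p"
      using kp[of k] Suc.prems by (subst ln_ge_iff[symmetric]) auto
    moreover have "2 * (k * p)\<^sup>2 \<le> 2 * p\<^sup>2 * (real n)\<^sup>2"
      using Suc.prems p by (auto simp: power_mult_distrib mult.commute[of "p\<^sup>2"] intro!: mult_right_mono power_mono)
    ultimately have step: "exp (- (k * p) - 2 * p\<^sup>2 * (real n)\<^sup>2) \<le> 1 - k * p"
      by (smt (verit) exp_le_cancel_iff)
    have "exp (- p * (Suc k * (real (Suc k) - 1) / 2) - 2 * p\<^sup>2 * Suc k * (real n)\<^sup>2) =
        exp (- p * (k * (real k - 1) / 2) - 2 * p\<^sup>2 * k * (real n)\<^sup>2) * exp (- (k * p) - 2 * p\<^sup>2 * (real n)\<^sup>2)"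
      by (simp add: field_simps flip: exp_add)
    also have "\<dots> \<le> d k * (1 - k * p)"
      using Suc step by (intro mult_mono) (auto intro: order_trans[OF exp_ge_zero])
    finally show ?case using lower[of k] Suc.prems by simp
  qed (simp add: d0)
  from this[of n] show "exp (- p * (n * (real n - 1) / 2) - 2 * p\<^sup>2 * real n ^ 3) \<le> d n"
    by (simp add: power2_eq_square power3_eq_cube mult.assoc)
  \<comment> \<open>From \<open>1 - y \<le> exp (- y)\<close>. The accumulated error is multiplied
    by a factor at most 1, and each step adds at most \<open>n\<^sup>2 p\<^sup>2\<close>.\<close>
  have "d k \<le> exp (- p * (k * (real k - 1) / 2)) + k * (real n)\<^sup>2 * p\<^sup>2" if "k \<le> n" for k
    using that
  proof (induction k)
    case (Suc k)
    have "d (Suc k) \<le> d k * (1 - k * p) + (real k)\<^sup>2 * p\<^sup>2" using upper Suc.prems by simp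
    also have "\<dots> \<le> (exp (- p * (k * (real k - 1) / 2)) + k * (real n)\<^sup>2 * p\<^sup>2) * (1 - k * p) + (real n)\<^sup>2 * p\<^sup>2"
      using Suc kp[of k] by (intro add_mono mult_right_mono) (auto intro: power_mono)
    also have "\<dots> \<le> exp (- p * (k * (real k - 1) / 2)) * exp (- (k * p)) + k * (real n)\<^sup>2 * p\<^sup>2 * 1 + (real n)\<^sup>2 * p\<^sup>2"
      using p exp_ge_add_one_self[of "- (k * p)"] unfolding distrib_right
      by (intro add_mono mult_left_mono order_refl) auto
    also have "\<dots> = exp (- p * (Suc k * (real (Suc k) - 1) / 2)) + Suc k * (real n)\<^sup>2 * p\<^sup>2"
      by (simp add: field_simps flip: exp_add)
    finally show ?case .
  qed (simp add: d0)
  from this[of n] show "d n \<le> exp (- p * (n * (real n - 1) / 2)) + p\<^sup>2 * real n ^ 3"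
    by (simp add: power2_eq_square power3_eq_cube mult_ac)
qed

text \<open>As \<open>n\<^sup>2 p\<close> converges, \<open>n p\<close> tends to 0, and so does the
  error \<open>n\<^sup>3 p\<^sup>2 = (n\<^sup>2 p) (n p)\<close>; the main exponent tends to
  \<open>- \<Lambda>\<close>.\<close>

lemma bounded_corner_limit:
  fixes x :: "nat \<Rightarrow> real"
  assumes prob: "\<And>n. n \<ge> 2 \<Longrightarrow> prob_space (corr_law n)"
    and lim: "(\<lambda>n. (real n)\<^sup>2 * entry_prob n {s. \<bar>s\<bar> > x n}) \<longlonglongrightarrow> 2 * \<Lambda>"
  shows "(\<lambda>n. measure (corr_law n) (bounded_corner n (x n) n)) \<longlonglongrightarrow> exp (- \<Lambda>)"
proof -
  define p where "p = (\<lambda>n. entry_prob n {s. \<bar>s\<bar> > x n})"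
  have p0: "0 \<le> p n" for n by (simp add: p_def entry_prob_def)
  have lim: "(\<lambda>n. (real n)\<^sup>2 * p n) \<longlonglongrightarrow> 2 * \<Lambda>" using lim by (simp add: p_def)
  have np: "(\<lambda>n. n * p n) \<longlonglongrightarrow> 0"
  proof (rule Lim_transform_eventually)
    have "(\<lambda>n. ((real n)\<^sup>2 * p n) * (1 / n)) \<longlonglongrightarrow> 2 * \<Lambda> * 0"
      by (intro tendsto_mult lim lim_1_over_n)
    then show "(\<lambda>n. ((real n)\<^sup>2 * p n) * (1 / n)) \<longlonglongrightarrow> 0" by simp
    show "\<forall>\<^sub>F n in sequentially. ((real n)\<^sup>2 * p n) * (1 / n) = n * p n"
      using eventually_gt_at_top[of 0] by eventually_elim (simp add: power2_eq_square)
  qed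
  have main: "(\<lambda>n. p n * (n * (real n - 1) / 2)) \<longlonglongrightarrow> \<Lambda>"
  proof -
    have "(\<lambda>n. (real n)\<^sup>2 * p n / 2 - n * p n / 2) \<longlonglongrightarrow> 2 * \<Lambda> / 2 - 0 / 2"
      by (intro tendsto_intros lim np) auto
    then show ?thesis by (simp add: power2_eq_square algebra_simps diff_divide_distrib)
  qed
  have err: "(\<lambda>n. (p n)\<^sup>2 * real n ^ 3) \<longlonglongrightarrow> 0"
  proof -
    have "(\<lambda>n. ((real n)\<^sup>2 * p n) * (n * p n)) \<longlonglongrightarrow> 2 * \<Lambda> * 0"
      by (intro tendsto_mult lim np)
    then show ?thesis by (simp add: power2_eq_square power3_eq_cube mult_ac)
  qed
  have ev: "\<forall>\<^sub>F n in sequentially. n \<ge> 2 \<and> n * p n \<le> 1 / 2"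
  proof -
    have "\<forall>\<^sub>F n in sequentially. n * p n < 1 / 2"
      by (rule order_tendstoD(2)[OF np]) simp
    then show ?thesis
      using eventually_ge_at_top[of 2] by eventually_elim simp
  qed
  have d0: "measure (corr_law n) (bounded_corner n (x n) 0) = 1" if "n \<ge> 2" for n
    using prob_space.prob_space[OF prob[OF that]] by (simp add: bounded_corner_def)
  show ?thesis
  proof (rule tendsto_sandwich)
    show "\<forall>\<^sub>F n in sequentially. exp (- p n * (n * (real n - 1) / 2) - 2 * (p n)\<^sup>2 * real n ^ 3)
        \<le> measure (corr_law n) (bounded_corner n (x n) n)"
      using ev
    proof eventually_elim
      case (elim n)
      then show ?case
        using bounded_corner_step[OF prob, of n _ "x n"]
        by (intro product_recursion_bounds(1)[of "\<lambda>k. measure (corr_law n) (bounded_corner n (x n) k)"] d0 p0)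
          (auto simp: p_def)
    qed
    show "\<forall>\<^sub>F n in sequentially. measure (corr_law n) (bounded_corner n (x n) n)
        \<le> exp (- p n * (n * (real n - 1) / 2)) + (p n)\<^sup>2 * real n ^ 3"
      using ev
    proof eventually_elim
      case (elim n)
      then show ?case
        using bounded_corner_step[OF prob, of n _ "x n"]
        by (intro product_recursion_bounds(2)[of "\<lambda>k. measure (corr_law n) (bounded_corner n (x n) k)"] d0 p0)
          (auto simp: p_def)
    qed
    have "(\<lambda>n. exp (- (p n * (n * (real n - 1) / 2)) - 2 * ((p n)\<^sup>2 * real n ^ 3))) \<longlonglongrightarrow> exp (- \<Lambda> - 2 * 0)"
      by (intro tendsto_intros main err)
    then show "(\<lambda>n. exp (- p n * (n * (real n - 1) / 2) - 2 * (p n)\<^sup>2 * real n ^ 3)) \<longlonglongrightarrow> exp (- \<Lambda>)"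
      by (simp add: mult.assoc)
    have "(\<lambda>n. exp (- (p n * (n * (real n - 1) / 2))) + (p n)\<^sup>2 * real n ^ 3) \<longlonglongrightarrow> exp (- \<Lambda>) + 0"
      by (intro tendsto_intros main err)
    then show "(\<lambda>n. exp (- p n * (n * (real n - 1) / 2)) + (p n)\<^sup>2 * real n ^ 3) \<longlonglongrightarrow> exp (- \<Lambda>)"
      by simp
  qed
qed

section \<open>Tail of a single entry\<close>

definition entry_density :: "nat \<Rightarrow> real \<Rightarrow> real" where
  "entry_density n s = indicator {-1<..<1} s * sqrt (1 - s\<^sup>2) ^ (n - 2)"

lemma entry_density_nonneg [simp]: "0 \<le> entry_density n s"
  by (auto simp: entry_density_def abs_square_le_1 split: split_indicator)

lemma measurable_entry_density [measurable]: "entry_density n \<in> borel_measurable borel"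
  unfolding entry_density_def by measurable

lemma measure_entry_measure:
  assumes "S \<in> sets borel"
  shows "measure (entry_measure n) S = enn2real (\<integral>\<^sup>+s. ennreal (entry_density n s) * indicator S s \<partial>lborel)"
  using assms
  by (simp add: measure_def entry_measure_def emeasure_density flip: entry_density_def)

text \<open>An integrable majorant for dominated convergence: \<open>1 - u \<le> exp (- u)\<close>
  together with \<open>(n - 2) / (2 n) \<ge> 1/4\<close>, which holds from \<open>n = 4\<close>
  on.\<close>

lemma entry_density_scaled_le:
  fixes y :: real
  assumes "4 \<le> n"
  shows "entry_density n (y / sqrt n) \<le> exp (- y\<^sup>2 / 4)"
proof (cases "y / sqrt n \<in> {-1<..<1}")
  case True
  then have "(y / sqrt n)\<^sup>2 < 1" using abs_square_less_1[of "y / sqrt n"] by (auto simp: abs_less_iff)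
  then have lt: "y\<^sup>2 / n < 1" by (simp add: power_divide)
  have "1 - y\<^sup>2 / n \<le> exp (- (y\<^sup>2 / n))" using exp_ge_add_one_self[of "- (y\<^sup>2 / n)"] by simp
  then have "sqrt (1 - y\<^sup>2 / n) \<le> sqrt (exp (- (y\<^sup>2 / n)))" by simp
  also have "\<dots> = exp (- (y\<^sup>2 / n) / 2)"
    by (rule real_sqrt_unique) (simp_all add: power2_eq_square flip: exp_add)
  finally have "sqrt (1 - y\<^sup>2 / n) ^ (n - 2) \<le> exp (- (y\<^sup>2 / n) / 2) ^ (n - 2)"
    using lt by (intro power_mono) auto
  also have "\<dots> = exp (- (y\<^sup>2 * ((real n - 2) / (2 * n))))"
    using assms by (simp add: of_nat_diff field_simps flip: exp_of_nat_mult)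
  also have "\<dots> \<le> exp (- (y\<^sup>2 * (1 / 4)))"
    using assms mult_right_mono[of 4 "real n" "y\<^sup>2"] by (simp add: field_simps)
  finally show ?thesis using True by (simp add: entry_density_def power_divide)
qed (simp add: entry_density_def)

lemma entry_density_scaled_tendsto:
  "(\<lambda>n. entry_density n (y / sqrt n)) \<longlonglongrightarrow> exp (- y\<^sup>2 / 2)"
proof (cases "y = 0")
  case True
  then show ?thesis by (simp add: entry_density_def)
next
  case False
  then have c: "0 < y\<^sup>2" by simp
  have "(\<lambda>n. exp ((real n - 2) / 2 * ln (1 - y\<^sup>2 / real n))) \<longlonglongrightarrow> exp (- y\<^sup>2 / 2)"
    using c by real_asymp
  moreover have "\<forall>\<^sub>F n in sequentially. exp ((real n - 2) / 2 * ln (1 - y\<^sup>2 / real n)) = entry_density n (y / sqrt n)"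
    \<comment> \<open>Once \<open>n > y\<^sup>2\<close>, the scaled point lies inside the support
      and the logarithm is defined.\<close>
    using eventually_ge_at_top[of 2] eventually_gt_at_top[of "nat \<lceil>y\<^sup>2\<rceil>"]
  proof eventually_elim
    case (elim n)
    then have lt: "y\<^sup>2 / n < 1" by (simp add: field_simps) linarith
    then have "(y / sqrt n)\<^sup>2 < 1" by (simp add: power_divide)
    then have "\<bar>y / sqrt n\<bar> < 1" using abs_square_less_1 by blast
    then have "y / sqrt n \<in> {-1<..<1}"
      unfolding greaterThanLessThan_iff by linarith
    then have "entry_density n (y / sqrt n) = sqrt (1 - y\<^sup>2 / n) ^ (n - 2)"
      by (simp add: entry_density_def power_divide)
    also have "\<dots> = (sqrt (1 - y\<^sup>2 / n)) powr (n - 2)"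
      using lt by (simp add: powr_realpow)
    also have "\<dots> = exp ((real n - 2) / 2 * ln (1 - y\<^sup>2 / n))"
      using lt elim by (simp add: powr_def ln_sqrt of_nat_diff)
    finally show ?case by simp
  qed
  ultimately show ?thesis by (rule Lim_transform_eventually)
qed

text \<open>After substituting \<open>s = y / sqrt n\<close>, dominated convergence yields the
  Gaussian integral.\<close>

lemma entry_measure_total_tendsto:
  "(\<lambda>n. sqrt n * measure (entry_measure n) UNIV) \<longlonglongrightarrow> sqrt (2 * pi)"
proof -
  have dens: "normal_density 0 (sqrt 2) y * sqrt (4 * pi) = exp (- y\<^sup>2 / 4)"
    "std_normal_density y * sqrt (2 * pi) = exp (- y\<^sup>2 / 2)" for y
    by (simp_all add: normal_density_def)
  have dom: "integrable lborel (\<lambda>y::real. exp (- y\<^sup>2 / 4))"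
    unfolding dens(1)[symmetric] by (intro integrable_mult_left integrable_normal_density) auto
  have gauss: "(\<integral>y. exp (- (y :: real)\<^sup>2 / 2) \<partial>lborel) = sqrt (2 * pi)"
    unfolding dens(2)[symmetric] by (subst integral_mult_left_zero) simp
  have scale: "(\<integral>y. entry_density n (y / sqrt n) \<partial>lborel) = sqrt n * measure (entry_measure n) UNIV" if "n > 0" for n
  proof -
    have "measure (entry_measure n) UNIV = (\<integral>s. entry_density n s \<partial>lborel)"
      by (simp add: measure_entry_measure integral_eq_nn_integral)
    also have "\<dots> = (1 / sqrt n) * (\<integral>y. entry_density n (y / sqrt n) \<partial>lborel)"
      using that by (subst lborel_integral_real_affine[where c = "1 / sqrt n" and t = 0]) auto
    finally show ?thesis using that by simp
  qed
  \<comment> \<open>The shift by 4 makes the majorant valid for every index.\<close>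
  have "(\<lambda>n. \<integral>y. entry_density (n + 4) (y / sqrt (real (n + 4))) \<partial>lborel) \<longlonglongrightarrow> (\<integral>y. exp (- y\<^sup>2 / 2) \<partial>lborel)"
  proof (rule integral_dominated_convergence[OF _ _ dom])
    show "AE y in lborel. (\<lambda>n. entry_density (n + 4) (y / sqrt (real (n + 4)))) \<longlonglongrightarrow> exp (- y\<^sup>2 / 2)"
      using LIMSEQ_ignore_initial_segment[OF entry_density_scaled_tendsto, of 4] by simp
    show "AE y in lborel. norm (entry_density (n + 4) (y / sqrt (real (n + 4)))) \<le> exp (- y\<^sup>2 / 4)" for n :: nat
      using entry_density_scaled_le[of "n + 4"] by simp
  qed measurable
  then have "(\<lambda>n. sqrt (real (n + 4)) * measure (entry_measure (n + 4)) UNIV) \<longlonglongrightarrow> sqrt (2 * pi)"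
    unfolding gauss by (subst (asm) scale) simp_all
  then show ?thesis
    by (intro LIMSEQ_offset[of "\<lambda>n. sqrt n * measure (entry_measure n) UNIV" 4]) simp
qed

text \<open>The counterpart of the Mills ratio: the leading term of the density's integral from
  \<open>x\<close> to 1.\<close>

definition tail_primitive :: "nat \<Rightarrow> real \<Rightarrow> real" where
  "tail_primitive n x = sqrt (1 - x\<^sup>2) ^ n / (n * x)"

text \<open>Minus the derivative of the primitive is the density times \<open>1 + (1 - s\<^sup>2) / (n s\<^sup>2)\<close>, and the
  second factor lies between 1 and \<open>1 + 1 / (n x\<^sup>2)\<close> on the interval from \<open>x\<close> to 1.\<close>

lemma nn_integral_tail_primitive:
  fixes x :: real
  assumes n: "3 \<le> n" and x: "0 < x" "x < 1"
  shows "(\<integral>\<^sup>+s. ennreal (sqrt (1 - s\<^sup>2) ^ (n - 2) * (1 + (1 - s\<^sup>2) / (n * s\<^sup>2))) * indicator {x..1} s \<partial>lborel)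
    = ennreal (tail_primitive n x)"
proof (rule nn_integral_has_integral_lebesgue')
  let ?\<psi> = "\<lambda>s :: real. sqrt (1 - s\<^sup>2) ^ (n - 2) * (1 + (1 - s\<^sup>2) / (n * s\<^sup>2))"
  have le1: "s\<^sup>2 \<le> 1" if "s \<in> {x..1}" for s
    using that x by (simp add: abs_square_le_1)
  show "0 \<le> ?\<psi> s" if "s \<in> {x..1}" for s
    using le1[OF that] by simp
  \<comment> \<open>The derivative is taken in the interior only, because the square root is
    singular at 1; continuity covers the endpoint, where the primitive vanishes.\<close>
  have "(?\<psi> has_integral (- tail_primitive n 1 - (- tail_primitive n x))) {x..1}"
  proof (rule fundamental_theorem_of_calculus_interior)
    show "x \<le> 1" using x by simp
    show "continuous_on {x..1} (\<lambda>s. - tail_primitive n s)"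
      unfolding tail_primitive_def using x n by (intro continuous_intros) auto
    fix s assume s: "s \<in> {x<..<1}"
    define r where "r = sqrt (1 - s\<^sup>2)"
    have "s\<^sup>2 < 1" using s x by (simp add: abs_square_less_1)
    then have r: "0 < r" "r\<^sup>2 = 1 - s\<^sup>2" by (simp_all add: r_def)
    obtain m where m: "n = Suc (Suc m)" by (rule that[of "n - 2"]) (use n in simp)
    have "((\<lambda>s. - (sqrt (1 - s\<^sup>2) ^ n / (n * s))) has_real_derivative
       - ((n * r ^ (n - 1) * (- (2 * s) * (inverse r / 2)) * (n * s) - r ^ n * n) / (n * s * (n * s)))) (at s)"
      using \<open>s\<^sup>2 < 1\<close> s x n unfolding r_def
      by (auto intro!: derivative_eq_intros)
    moreover have "- ((n * r ^ (n - 1) * (- (2 * s) * (inverse r / 2)) * (n * s) - r ^ n * n) / (n * s * (n * s)))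
      = r ^ m * (1 + r\<^sup>2 / (n * s\<^sup>2))"
    proof -
      have "- ((N * (r * P) * (- (2 * s) * (inverse r / 2)) * (N * s) - r * (r * P) * N) / (N * s * (N * s)))
          = P * (1 + r\<^sup>2 / (N * s\<^sup>2))" if "0 < N" for N P :: real
        using that r(1) s x by (simp add: field_simps power2_eq_square)
      from this[of "real n" "r ^ m"] show ?thesis using n by (simp add: m)
    qed
    ultimately show "((\<lambda>s. - tail_primitive n s) has_vector_derivative ?\<psi> s) (at s)"
      unfolding tail_primitive_def has_real_derivative_iff_has_vector_derivative[symmetric]
      by (simp add: r(2) m flip: r_def)
  qed
  then show "(?\<psi> has_integral tail_primitive n x) {x..1}"
    using n by (simp add: tail_primitive_def power_0_left)
qed

text \<open>The density is even and vanishes outside the open interval from -1 to 1; including the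
  endpoint \<open>x\<close> changes only a null set.\<close>

lemma entry_measure_tail_symmetric:
  fixes x :: real
  assumes x: "0 < x"
  shows "measure (entry_measure n) {s. \<bar>s\<bar> > x} =
    2 * enn2real (\<integral>\<^sup>+s. ennreal (entry_density n s) * indicator {x..1} s \<partial>lborel)"
proof -
  let ?I = "\<integral>\<^sup>+s. ennreal (entry_density n s) * indicator {x..1} s \<partial>lborel"
  have even: "entry_density n (- s) = entry_density n s" for s
    by (auto simp: entry_density_def split: split_indicator)
  have ae: "AE s in lborel. s \<noteq> x \<and> s \<noteq> - x"
    using AE_lborel_singleton[of x] AE_lborel_singleton[of "- x"] by eventually_elim auto
  have "(\<integral>\<^sup>+s. ennreal (entry_density n s) * indicator {s. \<bar>s\<bar> > x} s \<partial>lborel) =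
    (\<integral>\<^sup>+s. ennreal (entry_density n s) * indicator {x..1} s + ennreal (entry_density n (- s)) * indicator {x..1} (- s) \<partial>lborel)"
  proof (rule nn_integral_cong_AE, rule eventually_mono[OF ae])
    fix s assume "s \<noteq> x \<and> s \<noteq> - x"
    then show "ennreal (entry_density n s) * indicator {s. \<bar>s\<bar> > x} s =
      ennreal (entry_density n s) * indicator {x..1} s + ennreal (entry_density n (- s)) * indicator {x..1} (- s)"
      unfolding even using x by (cases "s \<in> {-1<..<1}") (auto simp: entry_density_def split: split_indicator)
  qed
  also have "\<dots> = ?I + (\<integral>\<^sup>+s. ennreal (entry_density n (- s)) * indicator {x..1} (- s) \<partial>lborel)"
    by (rule nn_integral_add) auto
  also have "(\<integral>\<^sup>+s. ennreal (entry_density n (- s)) * indicator {x..1} (- s) \<partial>lborel) = ?I"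
    by (subst nn_integral_real_affine[where c = "-1" and t = 0]) auto
  also have "?I + ?I = 2 * ?I" by (simp add: mult_2)
  finally show ?thesis
    by (simp add: measure_entry_measure enn2real_mult)
qed

text \<open>Compares the density with the integrand that has the explicit primitive. The bounds
  differ by the factor \<open>1 + 1 / (n x\<^sup>2)\<close>, which tends to 1 at the level used
  below.\<close>

lemma entry_measure_tail_bounds:
  fixes x :: real
  assumes n: "3 \<le> n" and x: "0 < x" "x < 1"
  shows "2 * tail_primitive n x / (1 + 1 / (n * x\<^sup>2)) \<le> measure (entry_measure n) {s. \<bar>s\<bar> > x}"
    and "measure (entry_measure n) {s. \<bar>s\<bar> > x} \<le> 2 * tail_primitive n x"
proof -
  let ?I = "\<integral>\<^sup>+s. ennreal (entry_density n s) * indicator {x..1} s \<partial>lborel"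
  let ?\<psi> = "\<lambda>s :: real. sqrt (1 - s\<^sup>2) ^ (n - 2) * (1 + (1 - s\<^sup>2) / (n * s\<^sup>2))"
  have tp: "0 \<le> tail_primitive n x" using x by (simp add: tail_primitive_def abs_square_le_1)
  have dens: "entry_density n s = sqrt (1 - s\<^sup>2) ^ (n - 2)" if "s \<in> {x..1}" for s
    using that x n by (auto simp: entry_density_def split: split_indicator)
  have le1: "s\<^sup>2 \<le> 1" if "s \<in> {x..1}" for s
    using that x by (simp add: abs_square_le_1)
  have "?I \<le> (\<integral>\<^sup>+s. ennreal (?\<psi> s) * indicator {x..1} s \<partial>lborel)"
  proof (intro nn_integral_mono)
    fix s :: real
    show "ennreal (entry_density n s) * indicator {x..1} s \<le> ennreal (?\<psi> s) * indicator {x..1} s"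
    proof (cases "s \<in> {x..1}")
      case True
      have "entry_density n s * 1 \<le> ?\<psi> s"
        unfolding dens[OF True] using le1[OF True] by (intro mult_left_mono) auto
      then show ?thesis using True by (simp add: ennreal_leI)
    qed simp
  qed
  then have upper: "?I \<le> ennreal (tail_primitive n x)"
    by (simp add: nn_integral_tail_primitive[OF n x])
  then have fin: "?I < \<top>" by (rule le_less_trans) simp
  have "enn2real ?I \<le> tail_primitive n x"
    using upper tp by (rule enn2real_leI[rotated])
  then show "measure (entry_measure n) {s. \<bar>s\<bar> > x} \<le> 2 * tail_primitive n x"
    using x by (simp add: entry_measure_tail_symmetric)
  define q where "q = 1 + 1 / (n * x\<^sup>2)"
  have q: "0 < q" using n x by (simp add: q_def add_pos_nonneg)
  have "ennreal (tail_primitive n x) \<le> (\<integral>\<^sup>+s. ennreal q * (ennreal (entry_density n s) * indicator {x..1} s) \<partial>lborel)"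
    unfolding nn_integral_tail_primitive[OF n x, symmetric]
  proof (intro nn_integral_mono)
    fix s :: real
    show "ennreal (?\<psi> s) * indicator {x..1} s \<le> ennreal q * (ennreal (entry_density n s) * indicator {x..1} s)"
    proof (cases "s \<in> {x..1}")
      case True
      have "(1 - s\<^sup>2) / (n * s\<^sup>2) \<le> 1 / (n * x\<^sup>2)"
        using True x n le1[OF True] by (intro frac_le mult_left_mono power_mono) auto
      then have "?\<psi> s \<le> entry_density n s * q"
        unfolding dens[OF True] q_def using le1[OF True] by (intro mult_left_mono) auto
      then have "ennreal (?\<psi> s) \<le> ennreal q * ennreal (entry_density n s)"
        using q by (simp add: ennreal_leI mult.commute flip: ennreal_mult)
      then show ?thesis using True by simp
    qed simp
  qed
  also have "\<dots> = ennreal q * ?I" by (rule nn_integral_cmult) measurable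
  also have "\<dots> = ennreal (q * enn2real ?I)"
    using q fin by (simp add: ennreal_mult)
  finally have "tail_primitive n x \<le> q * enn2real ?I"
    using q by (simp add: ennreal_le_iff)
  then have "2 * tail_primitive n x / q \<le> 2 * enn2real ?I"
    using q by (simp add: divide_le_eq mult.commute mult.left_commute)
  then show "2 * tail_primitive n x / (1 + 1 / (n * x\<^sup>2)) \<le> measure (entry_measure n) {s. \<bar>s\<bar> > x}"
    using x by (simp add: entry_measure_tail_symmetric q_def)
qed

text \<open>The level \<open>x\<close> solving
  \<open>(n + 1) x\<^sup>2 - centering n = t\<close>.\<close>

definition threshold :: "real \<Rightarrow> nat \<Rightarrow> real" where
  "threshold t n = sqrt ((centering n + t) / (real n + 1))"

text \<open>With \<open>y = x\<^sup>2\<close>, the power \<open>(1 - y) ^ (n / 2)\<close> is about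
  \<open>n\<^sup>-\<^sup>2 sqrt (ln n) exp (- t / 2)\<close> and \<open>n x\<close> is about
  \<open>2 sqrt (n ln n)\<close>. So the two tails have mass about
  \<open>n powr (-5/2) * exp (- t / 2)\<close>, against total mass about
  \<open>sqrt (2 pi / n)\<close>.\<close>

lemma entry_prob_threshold:
  "(\<lambda>n. (real n)\<^sup>2 * entry_prob n {s. \<bar>s\<bar> > threshold t n}) \<longlonglongrightarrow> 2 * (1 / sqrt (8 * pi) * exp (- t / 2))"
proof -
  define y where "y = (\<lambda>n. (centering n + t) / (real n + 1))"
  have thr: "threshold t n = sqrt (y n)" for n by (simp add: threshold_def y_def)
  have y_pos: "\<forall>\<^sub>F n in sequentially. 0 < y n"
    unfolding y_def centering_def by real_asymp
  have y_less: "\<forall>\<^sub>F n in sequentially. y n < 1"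
    unfolding y_def centering_def by real_asymp
  have ev: "\<forall>\<^sub>F n in sequentially. 3 \<le> n \<and> 0 < y n \<and> y n < 1"
    using eventually_ge_at_top[of 3] y_pos y_less by eventually_elim simp
  \<comment> \<open>Of the scaling, \<open>n\<^sup>2\<close> belongs to the claim and
    \<open>sqrt n\<close> compensates the decay of the total mass.\<close>
  define T where "T = (\<lambda>n. (real n)\<^sup>2 * sqrt n * (2 * tail_primitive n (threshold t n)))"
  have "(\<lambda>n. 2 * real n powr (3/2) * exp (n / 2 * ln (1 - y n)) / sqrt (y n)) \<longlonglongrightarrow> exp (- t / 2)"
    unfolding y_def centering_def by real_asymp
  moreover have "\<forall>\<^sub>F n in sequentially. 2 * real n powr (3/2) * exp (n / 2 * ln (1 - y n)) / sqrt (y n) = T n"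
    using ev
  proof eventually_elim
    case (elim n)
    have "sqrt (1 - y n) ^ n = exp (n / 2 * ln (1 - y n))"
      using elim by (simp add: powr_def ln_sqrt flip: powr_realpow)
    moreover have "real n powr (3/2) = n * sqrt n"
      using elim powr_add[of "real n" 1 "1/2"] by (simp add: powr_half_sqrt)
    ultimately show ?case
      using elim by (simp add: T_def thr tail_primitive_def power2_eq_square[of "real n"])
  qed
  ultimately have T: "T \<longlonglongrightarrow> exp (- t / 2)"
    by (rule Lim_transform_eventually)
  \<comment> \<open>Here \<open>n y\<close> grows like \<open>4 ln n\<close>, so the gap between the
    two tail bounds closes.\<close>
  have corr: "(\<lambda>n. 1 + 1 / (n * (threshold t n)\<^sup>2)) \<longlonglongrightarrow> 1"
  proof (rule Lim_transform_eventually)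
    show "(\<lambda>n. 1 + 1 / (n * y n)) \<longlonglongrightarrow> 1"
      unfolding y_def centering_def by real_asymp
    show "\<forall>\<^sub>F n in sequentially. 1 + 1 / (n * y n) = 1 + 1 / (n * (threshold t n)\<^sup>2)"
      using ev by eventually_elim (simp add: thr)
  qed
  have num: "(\<lambda>n. (real n)\<^sup>2 * sqrt n * measure (entry_measure n) {s. \<bar>s\<bar> > threshold t n}) \<longlonglongrightarrow> exp (- t / 2)"
  proof (rule tendsto_sandwich)
    have bounds: "\<forall>\<^sub>F n in sequentially. 3 \<le> n \<and> 0 < threshold t n \<and> threshold t n < 1"
      using ev by eventually_elim (simp add: thr)
    show "\<forall>\<^sub>F n in sequentially. T n / (1 + 1 / (n * (threshold t n)\<^sup>2)) \<le>
        (real n)\<^sup>2 * sqrt n * measure (entry_measure n) {s. \<bar>s\<bar> > threshold t n}"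
      using bounds
    proof eventually_elim
      case (elim n)
      then show ?case
        using mult_left_mono[OF entry_measure_tail_bounds(1)[of n "threshold t n"], of "(real n)\<^sup>2 * sqrt n"]
        by (simp add: T_def)
    qed
    show "\<forall>\<^sub>F n in sequentially. (real n)\<^sup>2 * sqrt n * measure (entry_measure n) {s. \<bar>s\<bar> > threshold t n} \<le> T n"
      using bounds
    proof eventually_elim
      case (elim n)
      then show ?case
        using mult_left_mono[OF entry_measure_tail_bounds(2)[of n "threshold t n"], of "(real n)\<^sup>2 * sqrt n"]
        by (simp add: T_def)
    qed
    show "(\<lambda>n. T n / (1 + 1 / (n * (threshold t n)\<^sup>2))) \<longlonglongrightarrow> exp (- t / 2)"
      using tendsto_divide[OF T corr] by simp
  qed (rule T)
  have "(\<lambda>n. (real n)\<^sup>2 * sqrt n * measure (entry_measure n) {s. \<bar>s\<bar> > threshold t n} /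
      (sqrt n * measure (entry_measure n) UNIV)) \<longlonglongrightarrow> exp (- t / 2) / sqrt (2 * pi)"
    by (intro tendsto_divide num entry_measure_total_tendsto) simp
  moreover have "\<forall>\<^sub>F n in sequentially. (real n)\<^sup>2 * sqrt n * measure (entry_measure n) {s. \<bar>s\<bar> > threshold t n} /
      (sqrt n * measure (entry_measure n) UNIV) = (real n)\<^sup>2 * entry_prob n {s. \<bar>s\<bar> > threshold t n}"
    using eventually_gt_at_top[of 0] by eventually_elim (simp add: entry_prob_def)
  ultimately have "(\<lambda>n. (real n)\<^sup>2 * entry_prob n {s. \<bar>s\<bar> > threshold t n}) \<longlonglongrightarrow> exp (- t / 2) / sqrt (2 * pi)"
    by (rule Lim_transform_eventually)
  moreover have "sqrt (8 * pi) = 2 * sqrt (2 * pi)"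
    using real_sqrt_mult[of 4 "2 * pi"] by simp
  ultimately show ?thesis by simp
qed

section \<open>Limit laws\<close>

lemma bounded_corner_limit_gumbel:
  assumes "\<And>n. n \<ge> 2 \<Longrightarrow> prob_space (corr_law n)"
  shows "(\<lambda>n. measure (corr_law n) (bounded_corner n (threshold t n) n)) \<longlonglongrightarrow> gumbel_cdf t"
  using bounded_corner_limit[OF assms entry_prob_threshold[of t]]
  by (simp add: gumbel_cdf_def)

lemma max_offdiag_le_iff:
  assumes "2 \<le> n"
  shows "max_offdiag n A \<le> x \<longleftrightarrow> offdiag_coords n A \<in> bounded_corner n x n"
proof -
  \<comment> \<open>For \<open>n \<ge> 2\<close> the index set is nonempty, so \<open>Max\<close> is
    a genuine maximum.\<close>
  have "(0, 1) \<in> offdiag n" using assms by (simp add: offdiag_def)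
  then have "max_offdiag n A \<le> x \<longleftrightarrow> (\<forall>p\<in>offdiag n. \<bar>A $$ p\<bar> \<le> x)"
    unfolding max_offdiag_def by (subst Max_le_iff) auto
  also have "\<dots> \<longleftrightarrow> (\<forall>l<n. \<forall>m<l. \<bar>A $$ (m, l)\<bar> \<le> x)"
    by (auto simp: offdiag_def)
  also have "\<dots> \<longleftrightarrow> (\<forall>l<n. \<forall>m<l. \<bar>corr_entry (offdiag_coords n A) m l\<bar> \<le> x)"
    by (simp add: corr_entry_less offdiag_coords_def offdiag_def)
  also have "\<dots> \<longleftrightarrow> offdiag_coords n A \<in> bounded_corner n x n"
    by (simp add: bounded_corner_def space_PiM PiE_def offdiag_coords_def)
  finally show ?thesis .
qed

lemma max_offdiag_nonneg:
  assumes "2 \<le> n"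
  shows "0 \<le> max_offdiag n A"
proof -
  have "(0, 1) \<in> offdiag n" using assms by (simp add: offdiag_def)
  then have "\<bar>A $$ (0, 1)\<bar> \<le> max_offdiag n A"
    unfolding max_offdiag_def by (intro Max_ge) auto
  then show ?thesis by linarith
qed

lemma le_threshold_iff:
  assumes "0 \<le> m" "0 \<le> centering n + t"
  shows "(real n + 1) * m\<^sup>2 - centering n \<le> t \<longleftrightarrow> m \<le> threshold t n"
proof -
  have "m \<le> threshold t n \<longleftrightarrow> m\<^sup>2 \<le> (centering n + t) / (real n + 1)"
    unfolding threshold_def using assms real_le_rsqrt
    by (metis abs_of_nonneg real_sqrt_abs real_sqrt_le_iff)
  also have "\<dots> \<longleftrightarrow> (real n + 1) * m\<^sup>2 - centering n \<le> t"
    by (simp add: le_divide_eq algebra_simps)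
  finally show ?thesis by simp
qed

section \<open>Transfer to the random matrices\<close>

lemma measurable_max_offdiag:
  assumes n: "2 \<le> n" and C: "uniform_correlation_matrix P n C"
  shows "(\<lambda>\<omega>. max_offdiag n (C \<omega>)) \<in> borel_measurable P"
proof (rule borel_measurableI_le)
  have meas: "(\<lambda>\<omega>. offdiag_coords n (C \<omega>)) \<in> measurable P (lebesgue_offdiag n)"
    using C by (simp add: uniform_correlation_matrix_def)
  show "{\<omega> \<in> space P. max_offdiag n (C \<omega>) \<le> x} \<in> sets P" for x
    unfolding max_offdiag_le_iff[OF n]
    using measurable_sets[OF meas sets_bounded_corner[OF order_refl, of n x]]
    by (simp add: vimage_def Int_def conj_commute)
qed

lemma prob_space_corr_law:
  assumes "prob_space P" and C: "uniform_correlation_matrix P n C"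
  shows "prob_space (corr_law n)"
  using prob_space.prob_space_distr[OF assms(1), of "\<lambda>\<omega>. offdiag_coords n (C \<omega>)" "lebesgue_offdiag n"] C
  by (simp add: uniform_correlation_matrix_def offdiag_coords_correlation_matrices)

lemma measure_max_offdiag_le:
  assumes n: "2 \<le> n" and C: "uniform_correlation_matrix P n C"
  shows "measure P {\<omega> \<in> space P. max_offdiag n (C \<omega>) \<le> x} = measure (corr_law n) (bounded_corner n x n)"
proof -
  have meas: "(\<lambda>\<omega>. offdiag_coords n (C \<omega>)) \<in> measurable P (lebesgue_offdiag n)"
    and law: "distr P (lebesgue_offdiag n) (\<lambda>\<omega>. offdiag_coords n (C \<omega>)) = corr_law n"
    using C by (simp_all add: uniform_correlation_matrix_def offdiag_coords_correlation_matrices)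
  show ?thesis
    unfolding max_offdiag_le_iff[OF n] law[symmetric]
    using measure_distr[OF meas sets_bounded_corner[OF order_refl, of n x]]
    by (simp add: vimage_def Int_def conj_commute)
qed

theorem corollary2:
  fixes P :: "nat \<Rightarrow> 'a measure"
    and C :: "nat \<Rightarrow> 'a \<Rightarrow> real mat"
  assumes "\<And>n. n \<ge> 2 \<Longrightarrow> prob_space (P n)"
    and "\<And>n. n \<ge> 2 \<Longrightarrow> uniform_correlation_matrix (P n) n (C n)"
  shows "weak_conv_m
           (\<lambda>n. distr (P n) borel
              (\<lambda>\<omega>. (real n + 1) * (max_offdiag n (C n \<omega>))\<^sup>2 - centering n))
           gumbel \<and>
         (\<forall>\<epsilon>>0. (\<lambda>n. measure (P n) {\<omega> \<in> space (P n).
              \<bar>sqrt ((real n + 1) / ln (real n)) * max_offdiag n (C n \<omega>) - 2\<bar> > \<epsilon>})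
            \<longlonglongrightarrow> 0)"
proof (intro conjI allI impI)
  define M where "M = (\<lambda>n \<omega>. max_offdiag n (C n \<omega>))"
  define Y where "Y = (\<lambda>n \<omega>. (real n + 1) * (M n \<omega>)\<^sup>2 - centering n)"
  define F where "F = (\<lambda>n t. measure (P n) {\<omega> \<in> space (P n). Y n \<omega> \<le> t})"
  have M_meas: "M n \<in> borel_measurable (P n)" if "2 \<le> n" for n
    unfolding M_def using that assms by (intro measurable_max_offdiag) auto
  have Y_meas: "Y n \<in> borel_measurable (P n)" if "2 \<le> n" for n
    using M_meas[OF that] unfolding Y_def by measurable
  have F: "(\<lambda>n. F n t) \<longlonglongrightarrow> gumbel_cdf t" for t
  proof (rule Lim_transform_eventually)
    show "(\<lambda>n. measure (corr_law n) (bounded_corner n (threshold t n) n)) \<longlonglongrightarrow> gumbel_cdf t"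
      using assms by (intro bounded_corner_limit_gumbel prob_space_corr_law) auto
    \<comment> \<open>The centering tends to infinity, so the radicand in \<open>threshold\<close>
      is eventually nonnegative and the event for \<open>Y\<close> becomes one for
      \<open>M\<close>.\<close>
    have "\<forall>\<^sub>F n in sequentially. 0 \<le> centering n + t"
      unfolding centering_def by real_asymp
    then show "\<forall>\<^sub>F n in sequentially. measure (corr_law n) (bounded_corner n (threshold t n) n) = F n t"
      using eventually_ge_at_top[of 2]
    proof eventually_elim
      case (elim n)
      have "F n t = measure (P n) {\<omega> \<in> space (P n). M n \<omega> \<le> threshold t n}"
        unfolding F_def Y_def M_def using elim
        by (simp add: le_threshold_iff max_offdiag_nonneg)
      then show ?case
        using elim assms by (simp add: M_def measure_max_offdiag_le)
    qed
  qed
  show "weak_conv_m (\<lambda>n. distr (P n) borel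
      (\<lambda>\<omega>. (real n + 1) * (max_offdiag n (C n \<omega>))\<^sup>2 - centering n)) gumbel"
    unfolding weak_conv_m_def weak_conv_def cdf_gumbel
  proof (intro allI impI)
    fix t
    have "\<forall>\<^sub>F n in sequentially. F n t = cdf (distr (P n) borel (Y n)) t"
      using eventually_ge_at_top[of 2]
    proof eventually_elim
      case (elim n)
      show ?case
        unfolding cdf_def F_def using Y_meas[OF elim]
        by (subst measure_distr) (auto intro!: arg_cong[of _ _ "measure (P n)"])
    qed
    from Lim_transform_eventually[OF F this]
    show "(\<lambda>n. cdf (distr (P n) borel (\<lambda>\<omega>. (real n + 1) * (max_offdiag n (C n \<omega>))\<^sup>2 - centering n)) t)
        \<longlonglongrightarrow> gumbel_cdf t"
      by (simp add: Y_def M_def)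
  qed
  fix \<epsilon> :: real assume \<epsilon>: "0 < \<epsilon>"
  define Q where "Q = (\<lambda>n. measure (P n) {\<omega> \<in> space (P n).
    \<bar>sqrt ((real n + 1) / ln (real n)) * M n \<omega> - 2\<bar> > \<epsilon>})"
  \<comment> \<open>The scaled maximum is \<open>sqrt ((centering n + Y) / ln n)\<close>, and
    \<open>centering n / ln n\<close> tends to 4. For \<open>Y\<close> between \<open>- T\<close>
    and \<open>T\<close> it is therefore eventually within \<open>\<epsilon>\<close> of 2, so a
    larger deviation forces \<open>Y\<close> into one of the tails.\<close>
  have Q_bound: "\<forall>\<^sub>F n in sequentially. Q n \<le> F n (- T) + (1 - F n T)" if "0 < T" for T
  proof -
    have lim: "(\<lambda>n. sqrt ((centering n + u) / ln (real n))) \<longlonglongrightarrow> 2" for u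
      unfolding centering_def by real_asymp
    have "\<forall>\<^sub>F n in sequentially. 2 - \<epsilon> < sqrt ((centering n + (- T)) / ln (real n))"
      by (rule order_tendstoD(1)[OF lim]) (use \<epsilon> in simp)
    moreover have "\<forall>\<^sub>F n in sequentially. sqrt ((centering n + T) / ln (real n)) < 2 + \<epsilon>"
      by (rule order_tendstoD(2)[OF lim]) (use \<epsilon> in simp)
    ultimately show ?thesis
      using eventually_ge_at_top[of 2]
    proof eventually_elim
      case (elim n)
      interpret prob_space "P n" using assms(1) elim(3) .
      note [measurable] = Y_meas[OF elim(3)]
      have ln: "0 < ln (real n)" using elim(3) by simp
      let ?lo = "{\<omega> \<in> space (P n). Y n \<omega> \<le> - T}" and ?hi = "{\<omega> \<in> space (P n). \<not> Y n \<omega> \<le> T}"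
      have "{\<omega> \<in> space (P n). \<bar>sqrt ((real n + 1) / ln (real n)) * M n \<omega> - 2\<bar> > \<epsilon>} \<subseteq> ?lo \<union> ?hi"
      proof (clarsimp)
        fix \<omega> assume dev: "\<epsilon> < \<bar>sqrt ((real n + 1) / ln (real n)) * M n \<omega> - 2\<bar>"
          and hi: "Y n \<omega> \<le> T"
        have eq: "sqrt ((real n + 1) / ln (real n)) * M n \<omega> = sqrt ((centering n + Y n \<omega>) / ln (real n))"
          using elim(3) max_offdiag_nonneg[of n "C n \<omega>"]
          by (simp add: Y_def M_def real_sqrt_mult real_sqrt_divide)
        show "Y n \<omega> \<le> - T"
        proof (rule ccontr)
          assume "\<not> Y n \<omega> \<le> - T"
          then have "sqrt ((centering n + (- T)) / ln (real n)) \<le> sqrt ((centering n + Y n \<omega>) / ln (real n))"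
            using ln by (intro real_sqrt_le_mono divide_right_mono) auto
          moreover have "sqrt ((centering n + Y n \<omega>) / ln (real n)) \<le> sqrt ((centering n + T) / ln (real n))"
            using ln hi by (intro real_sqrt_le_mono divide_right_mono) auto
          ultimately show False using elim(1,2) dev unfolding eq by linarith
        qed
      qed
      then have "Q n \<le> prob (?lo \<union> ?hi)"
        unfolding Q_def by (rule finite_measure_mono) measurable
      also have "\<dots> \<le> prob ?lo + prob ?hi"
        by (rule measure_Un_le) measurable
      also have "prob ?hi = 1 - F n T"
        unfolding F_def by (rule prob_neg) measurable
      finally show ?case by (simp add: F_def)
    qed
  qed
  have "Q \<longlonglongrightarrow> 0"
  proof (rule order_tendstoI)
    fix \<delta> :: real assume "\<delta> < 0"
    then show "\<forall>\<^sub>F n in sequentially. \<delta> < Q n"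
      by (intro always_eventually allI) (simp add: Q_def less_le_trans[OF _ measure_nonneg])
  next
    fix \<delta> :: real assume \<delta>: "0 < \<delta>"
    \<comment> \<open>Choose \<open>T\<close> with Gumbel tails of total mass below
      \<open>\<delta>\<close>; by the limit law, the bound on \<open>Q n\<close> is then eventually
      below \<open>\<delta>\<close> too.\<close>
    have "((\<lambda>T. gumbel_cdf (- T)) \<longlongrightarrow> 0) at_top"
      by (rule filterlim_compose[OF gumbel_cdf_properties(3) filterlim_uminus_at_bot_at_top])
    then have "((\<lambda>T. gumbel_cdf (- T) + (1 - gumbel_cdf T)) \<longlongrightarrow> 0 + (1 - 1)) at_top"
      by (intro tendsto_intros gumbel_cdf_properties(4))
    then have "\<forall>\<^sub>F T in at_top. gumbel_cdf (- T) + (1 - gumbel_cdf T) < \<delta>"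
      by (rule order_tendstoD(2)) (use \<delta> in simp)
    with eventually_gt_at_top[of 0]
    have "\<forall>\<^sub>F T in at_top. 0 < T \<and> gumbel_cdf (- T) + (1 - gumbel_cdf T) < \<delta>"
      by eventually_elim simp
    then obtain T where T: "0 < T" "gumbel_cdf (- T) + (1 - gumbel_cdf T) < \<delta>"
      using eventually_happens'[OF trivial_limit_at_top_linorder] by blast
    have "(\<lambda>n. F n (- T) + (1 - F n T)) \<longlonglongrightarrow> gumbel_cdf (- T) + (1 - gumbel_cdf T)"
      by (intro tendsto_intros F)
    from order_tendstoD(2)[OF this T(2)] Q_bound[OF T(1)]
    show "\<forall>\<^sub>F n in sequentially. Q n < \<delta>"
      by eventually_elim simp
  qed
  then show "(\<lambda>n. measure (P n) {\<omega> \<in> space (P n).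
      \<bar>sqrt ((real n + 1) / ln (real n)) * max_offdiag n (C n \<omega>) - 2\<bar> > \<epsilon>}) \<longlonglongrightarrow> 0"
    by (simp add: Q_def M_def)
qed

end
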